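(* Let $X$ be an order continuous Banach lattice and $(E_n)$ a bounded abstract bistochastic filtration on $X$. (1) For any martingale $(x_n)$ relative to $(E_n)$, if a subsequence $(x_{n_k})$ converges weakly to $x\in X$, then $(x_n)$ converges uo- and in norm to $x$. (2) For any submartingale $(z_n)$ relative to $(E_n)$, if a subsequence $(z_{n_k})$ converges weakly to $x\in X$, then $(z_n^+)$ converges uo- and in norm to $x^+$.
   Context: A Banach lattice is order continuous if every order null net is norm null. A filtration $(E_n)_{n\ge1}$ on $X$ is a sequence of positive (linear) projections on $X$ with $E_nE_m=E_mE_n=E_{\min(m,n)}$ for all $m,n\ge1$; it is bounded if $\sup_n\|E_n\|<\infty$. It is abstract bistochastic if there exist a weak unit $x_0>0$ in $X$ (i.e. $x\wedge nx_0\uparrow x$ for all $x\ge0$) and a strictly positive order continuous functional $x_0^*>0$ on $X$ (strictly positive: not vanishing on non-zero positive vectors; order continuous: mapping order null nets to order null nets) such that $E_1x_0=x_0$ and $E_1^*x_0^*=x_0^*$ (i.e. $x_0^*\circ E_1=x_0^*$). A sequence $(x_n)\subset X$ is a martingale relative to $(E_n)$ if $E_nx_m=x_n$ for all $m\ge n$; a sequence $(z_n)\subset X$ is a submartingale relative to $(E_n)$ if $z_n\in\mathrm{Range}(E_n)$ and $E_nz_m\ge z_n$ for all $m\ge n$. A net $(x_\alpha)$ order converges to $x$ ($x_\alpha\xrightarrow{o}x$) if there is a net $(y_\beta)$ (possibly over a different index set) with $y_\beta\downarrow 0$ such that for every $\beta$ there is $\alpha_0$ with $|x_\alpha-x|\le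 y_\beta$ for all $\alpha\ge\alpha_0$; it uo-converges to $x$ if $|x_\alpha-x|\wedge y\xrightarrow{o}0$ for all $y\in X_+$. *)

theory Defs
  imports "HOL-Analysis.Analysis" "HOL-Library.Lattice_Algebras"
begin

section \<open>Banach lattices\<close>

class banach_lattice = banach + ordered_real_vector + lattice_ab_group_add_abs +
  assumes norm_mono_abs: "\<bar>x\<bar> \<le> \<bar>y\<bar> \<Longrightarrow> norm x \<le> norm y"

instance real :: banach_lattice
  by standard simp


section \<open>Nets\<close>

definition directed_set :: "'i set \<Rightarrow> ('i \<Rightarrow> 'i \<Rightarrow> bool) \<Rightarrow> bool" where
  "directed_set A r \<longleftrightarrow> A \<noteq> {} \<and> (\<forall>a\<in>A. r a a) \<and>
     (\<forall>a\<in>A. \<forall>b\<in>A. \<forall>c\<in>A. r a b \<longrightarrow> r b c \<longrightarrow> r a c) \<and>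
     (\<forall>a\<in>A. \<forall>b\<in>A. \<exists>c\<in>A. r a c \<and> r b c)"

definition net_filter :: "'i set \<Rightarrow> ('i \<Rightarrow> 'i \<Rightarrow> bool) \<Rightarrow> 'i filter" where
  "net_filter A r = (INF a\<in>A. principal {b\<in>A. r a b})"

lemma eventually_net_filter:
  assumes "directed_set A r"
  shows "eventually P (net_filter A r) \<longleftrightarrow> (\<exists>a\<in>A. \<forall>b\<in>A. r a b \<longrightarrow> P b)"
proof -
  have "eventually P (net_filter A r) \<longleftrightarrow> (\<exists>a\<in>A. eventually P (principal {b\<in>A. r a b}))"
    unfolding net_filter_def
  proof (rule eventually_INF_base)
    show "A \<noteq> {}" using assms by (simp add: directed_set_def)
    fix a b assume "a \<in> A" "b \<in> A"
    then obtain c where "c \<in> A" "r a c" "r b c"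
      using assms unfolding directed_set_def by blast
    then show "\<exists>x\<in>A. principal {b \<in> A. r x b} \<le> inf (principal {b \<in> A. r a b}) (principal {c \<in> A. r b c})"
    proof (intro bexI)
      show "c \<in> A" by fact
      have "{d \<in> A. r c d} \<subseteq> {d \<in> A. r a d} \<inter> {d \<in> A. r b d}"
        using \<open>a \<in> A\<close> \<open>b \<in> A\<close> \<open>c \<in> A\<close> \<open>r a c\<close> \<open>r b c\<close> assms
        unfolding directed_set_def by blast
      then show "principal {d \<in> A. r c d} \<le> inf (principal {d \<in> A. r a d}) (principal {d \<in> A. r b d})"
        by simp
    qed
  qed
  then show ?thesis by (auto simp: eventually_principal)
qed

text \<open>Every proper filter is the image of the filter of a net on pairs (point, set). Hence
  quantifying over nets indexed by subsets of \<open>'a \<times> 'a set\<close> covers nets in \<open>'a\<close> with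
  arbitrary index sets.\<close>

lemma filter_as_net:
  fixes F :: "'a filter"
  assumes "F \<noteq> bot"
  obtains A :: "('a \<times> 'a set) set" and r where
    "directed_set A r" "filtermap fst (net_filter A r) = F"
proof
  define A where "A = {(a, S). a \<in> S \<and> eventually (\<lambda>x. x \<in> S) F}"
  define r where "r p q \<longleftrightarrow> snd q \<subseteq> snd p" for p q :: "'a \<times> 'a set"
  have ne: "\<exists>a. (a, S) \<in> A" if "eventually (\<lambda>x. x \<in> S) F" for S
    using that eventually_happens[OF that] assms by (auto simp: A_def)
  show dir: "directed_set A r"
    unfolding directed_set_def
  proof (intro conjI ballI impI)
    show "A \<noteq> {}" using ne[of UNIV] by auto
    fix p q assume pq: "p \<in> A" "q \<in> A"
    then have "eventually (\<lambda>x. x \<in> snd p \<inter> snd q) F"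
      by (auto simp: A_def intro: eventually_conj)
    from ne[OF this] obtain a where "(a, snd p \<inter> snd q) \<in> A" ..
    then show "\<exists>c\<in>A. r p c \<and> r q c" by (intro bexI) (auto simp: r_def)
  qed (auto simp: r_def)
  show "filtermap fst (net_filter A r) = F"
  proof (rule filter_eqI)
    fix P
    have "eventually P F" if "p \<in> A" "\<forall>q\<in>A. r p q \<longrightarrow> P (fst q)" for p
    proof -
      have "eventually (\<lambda>x. x \<in> snd p) F" using that(1) by (auto simp: A_def)
      then show ?thesis
      proof (rule eventually_mono)
        fix x assume "x \<in> snd p"
        then have "(x, snd p) \<in> A" using that(1) by (auto simp: A_def)
        then show "P x" using that(2) by (force simp: r_def)
      qed
    qed
    moreover have "\<exists>p\<in>A. \<forall>q\<in>A. r p q \<longrightarrow> P (fst q)" if ev: "eventually P F"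
    proof -
      obtain a where "(a, Collect P) \<in> A" using ne[of "Collect P"] ev by auto
      then show ?thesis by (intro bexI[of _ "(a, Collect P)"]) (auto simp: r_def A_def)
    qed
    ultimately show "eventually P (filtermap fst (net_filter A r)) = eventually P F"
      unfolding eventually_filtermap eventually_net_filter[OF dir] by blast
  qed
qed


section \<open>Order convergence and unbounded order convergence\<close>

definition net_decreases_to_zero ::
    "'i set \<Rightarrow> ('i \<Rightarrow> 'i \<Rightarrow> bool) \<Rightarrow> ('i \<Rightarrow> 'a::banach_lattice) \<Rightarrow> bool" where
  "net_decreases_to_zero B r y \<longleftrightarrow> directed_set B r \<and>
     (\<forall>b\<in>B. \<forall>c\<in>B. r b c \<longrightarrow> y c \<le> y b) \<and>
     (\<forall>b\<in>B. 0 \<le> y b) \<and> (\<forall>l. (\<forall>b\<in>B. l \<le> y b) \<longrightarrow> l \<le> 0)"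

text \<open>The dominating net may be taken to be indexed by a subset of the space itself: a decreasing
  net can be replaced by its range, directed by the reversed order
  (see \<open>order_tendstoI\<close>).\<close>

definition order_tendsto :: "('i \<Rightarrow> 'a::banach_lattice) \<Rightarrow> 'a \<Rightarrow> 'i filter \<Rightarrow> bool" where
  "order_tendsto f l F \<longleftrightarrow>
     (\<exists>(B :: 'a set) r (y :: 'a \<Rightarrow> 'a). net_decreases_to_zero B r y \<and>
        (\<forall>b\<in>B. \<forall>\<^sub>F i in F. \<bar>f i - l\<bar> \<le> y b))"

lemma order_tendstoI:
  fixes y :: "'j \<Rightarrow> 'a::banach_lattice"
  assumes "net_decreases_to_zero B r y"
    and "\<And>b. b \<in> B \<Longrightarrow> \<forall>\<^sub>F i in F. \<bar>f i - l\<bar> \<le> y b"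
  shows "order_tendsto f l F"
proof -
  note y = assms(1)[unfolded net_decreases_to_zero_def directed_set_def]
  have "B \<noteq> {}" using y by (elim conjE)
  have anti: "\<forall>b\<in>B. \<forall>c\<in>B. r b c \<longrightarrow> y c \<le> y b" using y by (elim conjE)
  have up: "\<forall>b\<in>B. \<forall>c\<in>B. \<exists>d\<in>B. r b d \<and> r c d" using y by (elim conjE)
  have lb: "\<forall>b\<in>B. 0 \<le> y b" using y by (elim conjE)
  have glb: "\<forall>m. (\<forall>b\<in>B. m \<le> y b) \<longrightarrow> m \<le> 0" using y by (elim conjE)
  have dir: "\<exists>d\<in>B. y d \<le> y b \<and> y d \<le> y c" if "b \<in> B" "c \<in> B" for b c
    using up anti that by meson
  have "directed_set (y ` B) (\<ge>)"
    unfolding directed_set_def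
  proof (intro conjI ballI impI)
    show "y ` B \<noteq> {}" using \<open>B \<noteq> {}\<close> by simp
    show "\<exists>c\<in>y ` B. c \<le> a \<and> c \<le> b" if "a \<in> y ` B" "b \<in> y ` B" for a b
      using that dir by blast
    show "c \<le> a" if "b \<le> a" "c \<le> b" for a b c :: 'a
      using that by (rule order_trans[rotated])
  qed simp
  then have "net_decreases_to_zero (y ` B) (\<ge>) (\<lambda>x. x)"
    using lb glb by (simp add: net_decreases_to_zero_def)
  then show ?thesis
    unfolding order_tendsto_def using assms(2) by blast
qed

definition uo_tendsto :: "('i \<Rightarrow> 'a::banach_lattice) \<Rightarrow> 'a \<Rightarrow> 'i filter \<Rightarrow> bool" where
  "uo_tendsto f l F \<longleftrightarrow> (\<forall>y\<ge>0. order_tendsto (\<lambda>i. inf \<bar>f i - l\<bar> y) 0 F)"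

definition weakly_tendsto :: "('i \<Rightarrow> 'a::real_normed_vector) \<Rightarrow> 'a \<Rightarrow> 'i filter \<Rightarrow> bool" where
  "weakly_tendsto f l F \<longleftrightarrow>
     (\<forall>\<phi> :: 'a \<Rightarrow> real. bounded_linear \<phi> \<longrightarrow> ((\<lambda>i. \<phi> (f i)) \<longlongrightarrow> \<phi> l) F)"


section \<open>Order continuity\<close>

definition order_continuous_norm :: "'a::banach_lattice itself \<Rightarrow> bool" where
  "order_continuous_norm _ \<longleftrightarrow>
     (\<forall>(A :: ('a \<times> 'a set) set) r (x :: 'a \<times> 'a set \<Rightarrow> 'a). directed_set A r \<longrightarrow>
        order_tendsto x 0 (net_filter A r) \<longrightarrow> (x \<longlongrightarrow> 0) (net_filter A r))"

definition order_continuous_functional :: "('a::banach_lattice \<Rightarrow> real) \<Rightarrow> bool" where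
  "order_continuous_functional \<phi> \<longleftrightarrow>
     (\<forall>(A :: ('a \<times> 'a set) set) r (x :: 'a \<times> 'a set \<Rightarrow> 'a). directed_set A r \<longrightarrow>
        order_tendsto x 0 (net_filter A r) \<longrightarrow> order_tendsto (\<lambda>i. \<phi> (x i)) 0 (net_filter A r))"

text \<open>Both notions apply to nets over arbitrary index types.\<close>

lemma order_tendsto_filtermap:
  "order_tendsto f l (filtermap g F) \<longleftrightarrow> order_tendsto (\<lambda>i. f (g i)) l F"
  by (simp add: order_tendsto_def eventually_filtermap)

lemma order_tendsto_bot: "order_tendsto f l bot"
  by (rule order_tendstoI[of "{()}" "\<lambda>_ _. True" "\<lambda>_. 0"])
    (auto simp: net_decreases_to_zero_def directed_set_def)

lemma order_continuous_normD:
  fixes f :: "'i \<Rightarrow> 'a::banach_lattice"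
  assumes "order_continuous_norm TYPE('a)" "order_tendsto f 0 F"
  shows "(f \<longlongrightarrow> 0) F"
proof (cases "F = bot")
  case False
  then have "filtermap f F \<noteq> bot" by (simp add: filtermap_bot_iff)
  then obtain A :: "('a \<times> 'a set) set" and r where
    A: "directed_set A r" "filtermap fst (net_filter A r) = filtermap f F"
    by (rule filter_as_net)
  have "order_tendsto (\<lambda>x. x) 0 (filtermap f F)"
    using assms(2) by (simp add: order_tendsto_filtermap)
  then have "order_tendsto fst 0 (net_filter A r)"
    by (simp add: order_tendsto_filtermap flip: A(2))
  then have "(fst \<longlongrightarrow> (0::'a)) (net_filter A r)"
    using assms(1) A(1) unfolding order_continuous_norm_def by blast
  then show ?thesis by (simp add: filterlim_def A(2))
qed simp

lemma order_continuous_functionalD: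
  fixes f :: "'i \<Rightarrow> 'a::banach_lattice"
  assumes "order_continuous_functional \<phi>" "order_tendsto f 0 F"
  shows "order_tendsto (\<lambda>i. \<phi> (f i)) 0 F"
proof (cases "F = bot")
  case False
  then have "filtermap f F \<noteq> bot" by (simp add: filtermap_bot_iff)
  then obtain A :: "('a \<times> 'a set) set" and r where
    A: "directed_set A r" "filtermap fst (net_filter A r) = filtermap f F"
    by (rule filter_as_net)
  have "order_tendsto (\<lambda>x. x) 0 (filtermap f F)"
    using assms(2) by (simp add: order_tendsto_filtermap)
  then have "order_tendsto fst 0 (net_filter A r)"
    by (simp add: order_tendsto_filtermap flip: A(2))
  then have "order_tendsto (\<lambda>i. \<phi> (fst i)) 0 (net_filter A r)"
    using assms(1) A(1) unfolding order_continuous_functional_def by blast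
  then have "order_tendsto \<phi> 0 (filtermap f F)"
    by (simp add: order_tendsto_filtermap flip: A(2))
  then show ?thesis by (simp add: order_tendsto_filtermap)
qed (simp add: order_tendsto_bot)


section \<open>Filtrations, martingales and submartingales\<close>

text \<open>Filtrations and (sub)martingales are indexed by the positive natural numbers; values at
  index \<open>0\<close> are irrelevant.\<close>

definition filtration :: "(nat \<Rightarrow> 'a::banach_lattice \<Rightarrow> 'a) \<Rightarrow> bool" where
  "filtration E \<longleftrightarrow> (\<forall>n\<ge>1. linear (E n) \<and> (\<forall>x\<ge>0. 0 \<le> E n x)) \<and>
     (\<forall>n\<ge>1. \<forall>m\<ge>1. E n \<circ> E m = E (min m n))"

text \<open>Boundedness of each \<open>E n\<close> is required because \<^const>\<open>onorm\<close> carries no information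
  for unbounded operators.\<close>

definition bounded_filtration :: "(nat \<Rightarrow> 'a::banach_lattice \<Rightarrow> 'a) \<Rightarrow> bool" where
  "bounded_filtration E \<longleftrightarrow> filtration E \<and>
     (\<forall>n\<ge>1. bounded_linear (E n)) \<and> bdd_above ((\<lambda>n. onorm (E n)) ` {1..})"

definition weak_unit :: "'a::banach_lattice \<Rightarrow> bool" where
  "weak_unit e \<longleftrightarrow> 0 < e \<and>
     (\<forall>x\<ge>0. incseq (\<lambda>n. inf x (real n *\<^sub>R e)) \<and>
        (\<forall>n. inf x (real n *\<^sub>R e) \<le> x) \<and>
        (\<forall>u. (\<forall>n. inf x (real n *\<^sub>R e) \<le> u) \<longrightarrow> x \<le> u))"

definition strictly_positive_functional :: "('a::banach_lattice \<Rightarrow> real) \<Rightarrow> bool" where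
  "strictly_positive_functional \<phi> \<longleftrightarrow>
     linear \<phi> \<and> (\<forall>x\<ge>0. 0 \<le> \<phi> x) \<and> (\<exists>x. \<phi> x \<noteq> 0) \<and> (\<forall>x>0. \<phi> x \<noteq> 0)"

definition abstract_bistochastic :: "(nat \<Rightarrow> 'a::banach_lattice \<Rightarrow> 'a) \<Rightarrow> bool" where
  "abstract_bistochastic E \<longleftrightarrow> filtration E \<and>
     (\<exists>e \<phi>. weak_unit e \<and> strictly_positive_functional \<phi> \<and> order_continuous_functional \<phi> \<and>
        E 1 e = e \<and> \<phi> \<circ> E 1 = \<phi>)"

definition martingale_rel :: "(nat \<Rightarrow> 'a::banach_lattice \<Rightarrow> 'a) \<Rightarrow> (nat \<Rightarrow> 'a) \<Rightarrow> bool" where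
  "martingale_rel E x \<longleftrightarrow> (\<forall>n\<ge>1. \<forall>m\<ge>n. E n (x m) = x n)"

definition submartingale_rel :: "(nat \<Rightarrow> 'a::banach_lattice \<Rightarrow> 'a) \<Rightarrow> (nat \<Rightarrow> 'a) \<Rightarrow> bool" where
  "submartingale_rel E z \<longleftrightarrow>
     (\<forall>n\<ge>1. z n \<in> range (E n)) \<and> (\<forall>n\<ge>1. \<forall>m\<ge>n. z n \<le> E n (z m))"

end

theory Submission
  imports Defs
begin

text \<open>
Let \<open>e\<close> be the weak unit and \<open>\<phi>\<close> the strictly positive functional, so that \<open>E n e = e\<close> and
\<open>\<phi> (E n x) = \<phi> x\<close> for all \<open>n \<ge> 1\<close>. The proof carries the classical arguments for conditional
expectations over to the lattice itself, without representing it as a function space: \<open>\<phi>\<close> replaces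
the integral, and projections onto bands replace multiplication by indicator functions.

\<^emph>\<open>Martingales.\<close> The positive cone is weakly closed, so letting \<open>m\<close> run through the subsequence in
\<open>E n (x m) = x n\<close> gives \<open>x n = E n l\<close>, where \<open>l\<close> is the weak limit
(\<open>submartingale_le_E_weak_limit\<close>). By Mazur's theorem \<open>l\<close> lies in the norm closure
of the union of the ranges of the \<open>E n\<close> (\<open>weak_limit_in_closure_subspace\<close>); on that union \<open>E n\<close>
is eventually the identity, and uniform boundedness gives norm convergence
(\<open>closed_martingale_tendsto\<close>). Both uses of weak limits rest on a form of the Hahn-Banach theorem
for sublinear functionals.

Unbounded order convergence comes from Doob's maximal inequality
\<open>\<phi> (inf (sup d) e) \<le> c \<phi> e + \<phi> (d 0) / c\<close> for finite suprema of non-negative supermartingales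
(\<open>doob_maximal_inequality\<close>). Its usual proof stops the process when it exceeds \<open>c\<close>; here the event is
a band, and the one property of conditional expectations that is required, compatibility with bands
generated by elements of the range, is \<open>band_proj_E_le\<close>. The band projections exist because in an order
continuous Banach lattice every order bounded increasing sequence converges in norm
(\<open>order_continuous_incseq_convergent\<close>). Applied to \<open>E n \<bar>l - v\<bar>\<close> with \<open>v\<close> close to \<open>l\<close> in the range of
some \<open>E m\<close>, the inequality shows that the tail suprema of \<open>\<bar>E n l - l\<bar>\<close> tend to 0 in the sense of
\<open>\<phi> (inf _ e)\<close>, and this implies unbounded order convergence because \<open>\<phi>\<close> is strictly
positive and \<open>e\<close> is a weak unit (\<open>tail_sup_null_order_tendsto\<close>).

\<^emph>\<open>Submartingales.\<close> The same passage to the limit gives \<open>z n \<le> E n l\<close>, so \<open>d n = E n l - z n\<close> is a non-negative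
supermartingale. The numbers \<open>\<phi> (d n)\<close> decrease, and tend to 0 along the subsequence, hence tend
to 0. The maximal inequality applied to \<open>d\<close> makes it null in the sense of unbounded order
convergence, and \<open>z n\<close> converges to \<open>l\<close> in this sense together with \<open>E n l\<close>. For the norm, the
positive part of \<open>z n\<close> lies between 0 and the positive part of \<open>E n l\<close>, which converges in
norm; domination and the order continuity of the norm then suffice.
\<close>

section \<open>Lattice operations and the norm\<close>

text \<open>The default rewriting moves a minus sign through \<open>sup\<close> and \<open>inf\<close>. Here differences of lattice
expressions are kept intact, since they are what the Lipschitz estimates below speak about.\<close>

declare neg_inf_eq_sup [simp del] neg_sup_eq_inf [simp del]
  diff_inf_eq_sup [simp del] diff_sup_eq_inf [simp del]

lemma norm_abs_lattice [simp]: "norm \<bar>x\<bar> = norm (x::'a::banach_lattice)"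
  by (intro antisym norm_mono_abs) simp_all

lemma norm_mono_nonneg:
  fixes x y :: "'a::banach_lattice"
  assumes "0 \<le> x" "x \<le> y"
  shows "norm x \<le> norm y"
  using assms by (intro norm_mono_abs) (simp add: abs_of_nonneg order_trans[OF assms])

text \<open>Translation invariance turns \<open>inf a c + inf b c\<close> into an infimum of the four sums
\<open>a + b\<close>, \<open>a + c\<close>, \<open>c + b\<close>, \<open>c + c\<close>, each of which dominates \<open>inf (a + b) c\<close>.\<close>

lemma inf_add_le:
  fixes a b c :: "'a::banach_lattice"
  assumes "0 \<le> a" "0 \<le> b" "0 \<le> c"
  shows "inf (a + b) c \<le> inf a c + inf b c"
proof -
  have "inf (a + b) c \<le> a + inf b c" "inf (a + b) c \<le> c + inf b c"
    using assms by (auto simp: add_inf_distrib_left intro: le_infI1 le_infI2 add_increasing add_increasing2)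
  then show ?thesis by (simp add: add_inf_distrib_right)
qed

lemma add_disjoint_eq_sup:
  fixes a b :: "'a::lattice_ab_group_add"
  assumes "inf a b = 0"
  shows "a + b = sup a b"
  using add_eq_inf_sup[of a b] assms by simp

text \<open>The lattice operations are 1-Lipschitz for the absolute value, hence norm continuous.\<close>

lemma abs_sup_diff_le: "\<bar>sup a c - sup b c\<bar> \<le> \<bar>a - b\<bar>" for a b c :: "'a::banach_lattice"
proof -
  have *: "sup a c \<le> \<bar>a - b\<bar> + sup b c" for a b :: 'a
  proof (rule sup_least)
    have "a = (a - b) + b" by simp
    also have "\<dots> \<le> \<bar>a - b\<bar> + sup b c" by (intro add_mono abs_ge_self sup_ge1)
    finally show "a \<le> \<bar>a - b\<bar> + sup b c" .
    show "c \<le> \<bar>a - b\<bar> + sup b c" by (intro add_increasing) auto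
  qed
  show ?thesis
    using *[of a b] *[of b a] by (intro abs_leI) (simp_all add: diff_le_eq minus_diff_eq abs_minus_commute)
qed

lemma abs_inf_diff_le: "\<bar>inf a c - inf b c\<bar> \<le> \<bar>a - b\<bar>" for a b c :: "'a::banach_lattice"
proof -
  have "inf a c - inf b c = - (sup (- a) (- c) - sup (- b) (- c))"
    by (simp only: inf_eq_neg_sup) simp
  then have "\<bar>inf a c - inf b c\<bar> = \<bar>sup (- a) (- c) - sup (- b) (- c)\<bar>"
    by (simp only: abs_minus_cancel)
  also have "\<dots> \<le> \<bar>- a - - b\<bar>" by (rule abs_sup_diff_le)
  also have "\<dots> = \<bar>a - b\<bar>" by (metis abs_minus_commute minus_diff_minus abs_minus_cancel)
  finally show ?thesis .
qed

lemma tendsto_if_abs_diff_le: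
  fixes f g :: "'i \<Rightarrow> 'a::banach_lattice"
  assumes "(f \<longlongrightarrow> l) F" "\<And>i. \<bar>g i - m\<bar> \<le> \<bar>f i - l\<bar>"
  shows "(g \<longlongrightarrow> m) F"
proof -
  have "((\<lambda>i. f i - l) \<longlongrightarrow> 0) F" using assms(1) by (simp add: LIM_zero)
  then have "((\<lambda>i. g i - m) \<longlongrightarrow> 0) F"
    by (rule Lim_null_comparison[OF always_eventually tendsto_norm_zero, rotated])
      (use assms(2) norm_mono_abs in blast)
  then show ?thesis by (rule LIM_zero_cancel)
qed

lemma tendsto_sup_const: "(f \<longlongrightarrow> l) F \<Longrightarrow> ((\<lambda>i. sup (f i) c) \<longlongrightarrow> sup l c) F"
  for f :: "'i \<Rightarrow> 'a::banach_lattice"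
  by (rule tendsto_if_abs_diff_le) (auto intro: abs_sup_diff_le)

lemma tendsto_inf_const: "(f \<longlongrightarrow> l) F \<Longrightarrow> ((\<lambda>i. inf (f i) c) \<longlongrightarrow> inf l c) F"
  for f :: "'i \<Rightarrow> 'a::banach_lattice"
  by (rule tendsto_if_abs_diff_le) (auto intro: abs_inf_diff_le)

text \<open>The positive cone is norm closed, because \<open>x \<mapsto> sup x 0\<close> is continuous.\<close>

lemma tendsto_le_lattice:
  fixes f g :: "'i \<Rightarrow> 'a::banach_lattice"
  assumes "F \<noteq> bot" "(f \<longlongrightarrow> l) F" "(g \<longlongrightarrow> m) F" "\<forall>\<^sub>F i in F. f i \<le> g i"
  shows "l \<le> m"
proof -
  have "((\<lambda>i. sup (f i - g i) 0) \<longlongrightarrow> sup (l - m) 0) F"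
    by (intro tendsto_sup_const tendsto_diff assms)
  moreover have "((\<lambda>i. sup (f i - g i) 0) \<longlongrightarrow> 0) F"
    by (rule tendsto_eventually) (use assms(4) in eventually_elim, simp add: sup_absorb2)
  ultimately have "sup (l - m) 0 = 0" using tendsto_unique assms(1) by blast
  then have "l - m \<le> 0" by (metis sup_ge1)
  then show ?thesis by simp
qed

lemma archimedean_eq_0:
  fixes v y :: "'a::banach_lattice"
  assumes "0 \<le> v" "\<And>k. real k *\<^sub>R v \<le> y"
  shows "v = 0"
proof (rule ccontr)
  assume "v \<noteq> 0"
  then obtain k :: nat where k: "norm y < real k * norm v"
    using reals_Archimedean3[of "norm v"] by auto
  have "norm (real k *\<^sub>R v) \<le> norm y"
    using assms by (intro norm_mono_nonneg) (auto simp: scaleR_nonneg_nonneg)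
  with k show False by simp
qed

lemma scaleR_inf:
  fixes a b :: "'a::banach_lattice"
  assumes "0 \<le> c"
  shows "c *\<^sub>R inf a b = inf (c *\<^sub>R a) (c *\<^sub>R b)"
proof (cases "c = 0")
  case False
  then have c: "0 < c" using assms by simp
  show ?thesis
  proof (rule antisym)
    show "c *\<^sub>R inf a b \<le> inf (c *\<^sub>R a) (c *\<^sub>R b)"
      using assms by (simp add: scaleR_left_mono)
    have "(1 / c) *\<^sub>R inf (c *\<^sub>R a) (c *\<^sub>R b) \<le> (1 / c) *\<^sub>R (c *\<^sub>R x)" if "x = a \<or> x = b" for x
      using that c by (intro scaleR_left_mono) auto
    then have "(1 / c) *\<^sub>R inf (c *\<^sub>R a) (c *\<^sub>R b) \<le> inf a b"
      using c by auto
    from scaleR_left_mono[OF this assms] c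
    show "inf (c *\<^sub>R a) (c *\<^sub>R b) \<le> c *\<^sub>R inf a b" by simp
  qed
qed simp

lemma scaleR_sup:
  fixes a b :: "'a::banach_lattice"
  assumes "0 \<le> c"
  shows "c *\<^sub>R sup a b = sup (c *\<^sub>R a) (c *\<^sub>R b)"
  using scaleR_inf[OF assms, of "- a" "- b"]
  by (simp only: sup_eq_neg_inf[of a b] sup_eq_neg_inf[of "c *\<^sub>R a" "c *\<^sub>R b"] scaleR_minus_right)

lemma disjoint_scaleR:
  fixes z u :: "'a::banach_lattice"
  assumes "0 \<le> z" "0 \<le> u" "inf z u = 0"
  shows "inf z (real k *\<^sub>R u) = 0"
proof (rule antisym)
  have "inf z (real k *\<^sub>R u) \<le> inf (real (Suc k) *\<^sub>R z) (real (Suc k) *\<^sub>R u)"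
  proof (intro inf_mono)
    have "1 *\<^sub>R z \<le> real (Suc k) *\<^sub>R z" using assms by (intro scaleR_right_mono) auto
    then show "z \<le> real (Suc k) *\<^sub>R z" by simp
    show "real k *\<^sub>R u \<le> real (Suc k) *\<^sub>R u" using assms by (intro scaleR_right_mono) auto
  qed
  also have "\<dots> = 0" using assms(3) by (simp flip: scaleR_inf)
  finally show "inf z (real k *\<^sub>R u) \<le> 0" .
  show "0 \<le> inf z (real k *\<^sub>R u)" using assms by (simp add: scaleR_nonneg_nonneg)
qed

text \<open>If a positive functional were unbounded on the positive part of the unit ball, one could choose
\<open>x n\<close> there with value above \<open>4 ^ n\<close>. By completeness the series of the \<open>x n / 2 ^ n\<close> converges, and
its sum dominates every term, so the functional would exceed \<open>2 ^ n\<close> at it for every \<open>n\<close>.\<close>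

lemma positive_functional_bounded_linear:
  fixes \<phi> :: "'a::banach_lattice \<Rightarrow> real"
  assumes lin: "linear \<phi>" and pos: "\<And>x. 0 \<le> x \<Longrightarrow> 0 \<le> \<phi> x"
  shows "bounded_linear \<phi>"
proof -
  have mono: "\<phi> x \<le> \<phi> y" if "x \<le> y" for x y
    using pos[of "y - x"] that by (simp add: linear_diff[OF lin])
  have "\<exists>K. \<forall>x\<ge>0. norm x \<le> 1 \<longrightarrow> \<phi> x \<le> K"
  proof (rule ccontr)
    assume "\<not> ?thesis"
    then have "\<exists>x\<ge>0. norm x \<le> 1 \<and> 4 ^ n < \<phi> x" for n :: nat
      by (meson not_le)
    then obtain x :: "nat \<Rightarrow> 'a" where x: "\<And>n. 0 \<le> x n" "\<And>n. norm (x n) \<le> 1" "\<And>n. 4 ^ n < \<phi> (x n)"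
      by metis
    define y where "y n = (1 / 2) ^ n *\<^sub>R x n" for n
    have "summable y"
    proof (rule summable_comparison_test')
      show "summable (\<lambda>n. (1 / 2 :: real) ^ n)" by (rule summable_geometric) simp
      show "norm (y n) \<le> (1 / 2) ^ n" for n using x(2)[of n] by (simp add: y_def divide_simps)
    qed
    have y0: "0 \<le> y n" for n using x by (simp add: y_def scaleR_nonneg_nonneg)
    have "y n \<le> suminf y" for n
    proof (rule tendsto_le_lattice[OF _ tendsto_const summable_LIMSEQ[OF \<open>summable y\<close>]])
      show "\<forall>\<^sub>F k in sequentially. y n \<le> sum y {..<k}"
        using eventually_gt_at_top[of n]
      proof eventually_elim
        case (elim k)
        then show ?case using sum_mono2[of "{..<k}" "{n}" y] y0 by simp
      qed
    qed simp
    then have "\<phi> (y n) \<le> \<phi> (suminf y)" for n by (rule mono)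
    moreover have "2 ^ n < \<phi> (y n)" for n
    proof -
      have "2 ^ n = (1/2) ^ n * (4 :: real) ^ n" by (simp flip: power_mult_distrib)
      also have "\<dots> < (1/2) ^ n * \<phi> (x n)" using x by (intro mult_strict_left_mono) auto
      finally show ?thesis by (simp add: y_def linear_scale[OF lin])
    qed
    moreover obtain n where "\<phi> (suminf y) < 2 ^ n"
      using real_arch_pow[of 2] by auto
    ultimately show False by (meson less_le_trans not_less order_less_imp_le)
  qed
  then obtain K where K: "\<And>x. 0 \<le> x \<Longrightarrow> norm x \<le> 1 \<Longrightarrow> \<phi> x \<le> K" by blast
  have "\<bar>\<phi> x\<bar> \<le> norm x * K" for x
  proof (cases "x = 0")
    case False
    have "\<bar>\<phi> x\<bar> \<le> \<phi> \<bar>x\<bar>"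
      using mono[of x "\<bar>x\<bar>"] mono[of "- x" "\<bar>x\<bar>"] by (simp add: linear_neg[OF lin] abs_ge_self abs_ge_minus_self)
    also have "\<dots> = norm x * \<phi> ((1 / norm x) *\<^sub>R \<bar>x\<bar>)"
      using False by (simp add: linear_scale[OF lin])
    also have "\<dots> \<le> norm x * K"
      using False by (intro mult_left_mono K) (auto intro!: scaleR_nonneg_nonneg)
    finally show ?thesis .
  qed (simp add: linear_0[OF lin])
  then show ?thesis
    using lin by (intro bounded_linear_intro[of _ K]) (auto simp: linear_add linear_scale)
qed

section \<open>The Hahn-Banach theorem and weak limits\<close>

definition sublinear :: "('a::real_vector \<Rightarrow> real) \<Rightarrow> bool" where
  "sublinear p \<longleftrightarrow> (\<forall>x y. p (x + y) \<le> p x + p y) \<and> (\<forall>c\<ge>0. \<forall>x. p (c *\<^sub>R x) = c * p x)"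

lemma sublinear_add: "sublinear p \<Longrightarrow> p (x + y) \<le> p x + p y"
  and sublinear_scale: "sublinear p \<Longrightarrow> 0 \<le> c \<Longrightarrow> p (c *\<^sub>R x) = c * p x"
  by (auto simp: sublinear_def)

lemma sublinear_0: "sublinear p \<Longrightarrow> p 0 = 0"
  using sublinear_scale[of p 0 0] by simp

lemma sublinear_neg: "sublinear p \<Longrightarrow> - p (- x) \<le> p x"
  using sublinear_add[of p x "- x"] sublinear_0[of p] by simp

text \<open>One step of lowering a sublinear functional: \<open>q x = inf {p (x + t a) - t p a | t \<ge> 0}\<close> lies below
\<open>p\<close>, and \<open>t = 1\<close> gives the last inequality. It serves twice below: at \<open>x = - a\<close> it forces
\<open>q (- a) \<le> - p a\<close>, and at a minimal \<open>p\<close>, where necessarily \<open>q = p\<close>, it makes \<open>p\<close> additive.\<close>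

lemma sublinear_direction:
  fixes p :: "'a::real_vector \<Rightarrow> real"
  assumes p: "sublinear p"
  obtains q where "sublinear q" "\<And>x. q x \<le> p x" "\<And>x. q x \<le> p (x + a) - p a"
proof
  define V where "V x = (\<lambda>t. p (x + t *\<^sub>R a) - t * p a) ` {0..}" for x
  define q where "q x = Inf (V x)" for x
  have bdd: "bdd_below (V x)" for x
  proof (rule bdd_belowI)
    fix v assume "v \<in> V x"
    then obtain t where "0 \<le> t" "v = p (x + t *\<^sub>R a) - t * p a" by (auto simp: V_def)
    then show "- p (- x) \<le> v"
      using sublinear_add[OF p, of "x + t *\<^sub>R a" "- x"] sublinear_scale[OF p, of t a] by simp
  qed
  have ne: "V x \<noteq> {}" for x by (auto simp: V_def)
  have le: "q x \<le> p (x + t *\<^sub>R a) - t * p a" if "0 \<le> t" for x t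
    unfolding q_def by (rule cInf_lower[OF _ bdd]) (use that in \<open>auto simp: V_def\<close>)
  have ge: "z \<le> q x" if "\<And>t. 0 \<le> t \<Longrightarrow> z \<le> p (x + t *\<^sub>R a) - t * p a" for z x
    unfolding q_def by (rule cInf_greatest[OF ne]) (use that in \<open>auto simp: V_def\<close>)
  show "q x \<le> p x" for x using le[of 0 x] by simp
  show "q x \<le> p (x + a) - p a" for x using le[of 1 x] by simp
  have add: "q (x + y) \<le> q x + q y" for x y
  proof -
    have "q (x + y) - (p (x + s *\<^sub>R a) - s * p a) \<le> p (y + t *\<^sub>R a) - t * p a" if "0 \<le> s" "0 \<le> t" for s t
      using le[of "s + t" "x + y"] that sublinear_add[OF p, of "x + s *\<^sub>R a" "y + t *\<^sub>R a"]
      by (simp add: algebra_simps)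
    then have "q (x + y) - (p (x + s *\<^sub>R a) - s * p a) \<le> q y" if "0 \<le> s" for s
      using that by (intro ge)
    then have "q (x + y) - q y \<le> q x" by (intro ge) (force simp: algebra_simps)
    then show ?thesis by simp
  qed
  have scale_le: "q (c *\<^sub>R x) \<le> c * q x" if "0 < c" for c x
  proof -
    have "q (c *\<^sub>R x) / c \<le> q x"
    proof (rule ge)
      fix t :: real assume "0 \<le> t"
      have "q (c *\<^sub>R x) \<le> p (c *\<^sub>R x + (c * t) *\<^sub>R a) - (c * t) * p a"
        using that \<open>0 \<le> t\<close> by (intro le) auto
      also have "c *\<^sub>R x + (c * t) *\<^sub>R a = c *\<^sub>R (x + t *\<^sub>R a)" by (simp add: algebra_simps)
      finally show "q (c *\<^sub>R x) / c \<le> p (x + t *\<^sub>R a) - t * p a"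
        using that by (simp add: sublinear_scale[OF p, of c] pos_divide_le_eq) (simp add: algebra_simps)
    qed
    then show ?thesis using that by (simp add: field_simps)
  qed
  have scale: "q (c *\<^sub>R x) = c * q x" if "0 < c" for c x
    using scale_le[OF that, of x] scale_le[of "1 / c" "c *\<^sub>R x"] that
    by (simp add: field_simps)
  have "q 0 = 0"
    using scale[of 2 0] by simp
  then show "sublinear q"
    unfolding sublinear_def using add scale by (metis mult_zero_left order_le_less scaleR_zero_left)
qed

text \<open>A minimal sublinear functional is linear. Zorn's lemma is applied below a functional \<open>p1 \<le> p\<close>
already lowered in the direction \<open>a\<close>, so that every linear functional found there satisfies
\<open>f (- a) \<le> - p a\<close>, that is, \<open>f a \<ge> p a\<close>.\<close>

lemma hahn_banach_dominated:
  fixes p :: "'a::real_vector \<Rightarrow> real"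
  assumes p: "sublinear p"
  obtains f where "linear f" "\<And>x. f x \<le> p x" "f a = p a"
proof -
  obtain p1 where p1: "sublinear p1" "\<And>x. p1 x \<le> p x" "\<And>x. p1 x \<le> p (x + a) - p a"
    using sublinear_direction[OF p] by blast
  define A where "A = {q. sublinear q \<and> q \<le> p1}"
  have "\<exists>m\<in>A. \<forall>q\<in>A. m \<ge> q \<longrightarrow> q = m"
  proof (rule predicate_Zorn)
    show "partial_order_on A (relation_of (\<ge>) A)"
      by (auto simp: partial_order_on_def preorder_on_def refl_on_def trans_def antisym_def relation_of_def)
    fix C assume "C \<in> Chains (relation_of (\<ge>) A)"
    then have CA: "C \<subseteq> A" and chain: "\<And>q r. q \<in> C \<Longrightarrow> r \<in> C \<Longrightarrow> q \<le> r \<or> r \<le> q"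
      by (auto simp: Chains_def relation_of_def)
    show "\<exists>u\<in>A. \<forall>q\<in>C. u \<le> q"
    proof (cases "C = {}")
      case True
      then show ?thesis using p1 by (auto simp: A_def)
    next
      case False
      \<comment> \<open>The lower bound of a chain is its pointwise infimum; comparability within the chain is what
        keeps it subadditive.\<close>
      define u where "u x = (INF q\<in>C. q x)" for x
      have sub: "sublinear q" if "q \<in> C" for q using CA that by (auto simp: A_def)
      have "bdd_below ((\<lambda>q. q x) ` C)" for x
      proof (rule bdd_belowI2)
        fix q assume "q \<in> C"
        then have "sublinear q" "q (- x) \<le> p1 (- x)" using CA by (auto simp: A_def le_fun_def)
        then show "- p1 (- x) \<le> q x" using sublinear_neg[of q x] by linarith
      qed
      then have le: "u x \<le> q x" if "q \<in> C" for q x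
        using that by (auto simp: u_def intro: cINF_lower)
      have ge: "z \<le> u x" if "\<And>q. q \<in> C \<Longrightarrow> z \<le> q x" for z x
        unfolding u_def using False that by (intro cINF_greatest)
      have "u (x + y) \<le> u x + u y" for x y
      proof -
        have "u (x + y) - r y \<le> q x" if qr: "q \<in> C" "r \<in> C" for q r
        proof -
          obtain s where "s \<in> C" "s \<le> q" "s \<le> r" using chain[OF qr] qr by auto
          then have "u (x + y) \<le> s x + s y" "s x \<le> q x" "s y \<le> r y"
            using le[of s "x + y"] sublinear_add[OF sub, of s x y] by (auto simp: le_fun_def)
          then show ?thesis by linarith
        qed
        then have "u (x + y) - r y \<le> u x" if "r \<in> C" for r using that by (intro ge)
        then have "u (x + y) - u x \<le> u y" by (intro ge) (force simp: algebra_simps)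
        then show ?thesis by simp
      qed
      moreover have scale: "u (c *\<^sub>R x) = c * u x" if "0 < c" for c x
      proof (rule antisym)
        have "u (c *\<^sub>R x) / c \<le> u x"
          using le[of _ "c *\<^sub>R x"] sub that by (intro ge) (simp add: sublinear_scale field_simps)
        then show "u (c *\<^sub>R x) \<le> c * u x" using that by (simp add: field_simps)
        show "c * u x \<le> u (c *\<^sub>R x)"
          using le[of _ x] sub that by (intro ge) (simp add: sublinear_scale)
      qed
      moreover have "u 0 = 0" using scale[of 2 0] by simp
      ultimately have "sublinear u"
        unfolding sublinear_def by (metis mult_zero_left order_le_less scaleR_zero_left)
      moreover have "u \<le> p1"
      proof -
        obtain q where "q \<in> C" using False by blast
        then have "u \<le> q" "q \<le> p1" using CA le by (auto simp: A_def le_fun_def)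
        then show ?thesis by (rule order_trans)
      qed
      ultimately show ?thesis using le by (intro bexI[of _ u]) (auto simp: A_def le_fun_def)
    qed
  qed
  then obtain f where f: "sublinear f" "f \<le> p1"
    and "\<And>q. q \<in> A \<Longrightarrow> q \<le> f \<Longrightarrow> q = f"
    by (auto simp: A_def)
  then have minimal: "q = f" if "sublinear q" "q \<le> f" for q
    using that by (auto simp: A_def intro: order_trans)
  have add: "f (x + y) = f x + f y" for x y
  proof -
    obtain q where q: "sublinear q" "\<And>x. q x \<le> f x" "\<And>x. q x \<le> f (x + y) - f y"
      using sublinear_direction[OF f(1)] by blast
    then have "q = f" using minimal by (simp add: le_fun_def)
    then show ?thesis using q(3)[of x] sublinear_add[OF f(1), of x y] by simp
  qed
  have neg: "f (- x) = - f x" for x using add[of x "- x"] sublinear_0[OF f(1)] by simp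
  have "linear f"
  proof (rule linearI)
    show "f (c *\<^sub>R x) = c *\<^sub>R f x" for c x
    proof (cases "0 \<le> c")
      case False
      then have "f ((- c) *\<^sub>R x) = (- c) * f x" by (intro sublinear_scale f) simp
      then show ?thesis by (simp add: neg)
    qed (simp add: sublinear_scale[OF f(1)])
  qed (rule add)
  moreover have fp: "f x \<le> p x" for x using f(2) p1(2)[of x] by (auto simp: le_fun_def intro: order_trans)
  moreover have "f a = p a"
  proof (rule antisym)
    have "f (- a) \<le> p1 (- a)" using f(2) by (simp add: le_fun_def)
    also have "\<dots> \<le> - p a" using p1(3)[of "- a"] sublinear_0[OF p] by simp
    finally show "p a \<le> f a" by (simp add: neg)
  qed (rule fp)
  ultimately show ?thesis using that by blast
qed

text \<open>Sublevel sets \<open>{x. p x \<le> 0}\<close> of continuous sublinear functionals are weakly closed: a linear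
functional below \<open>p\<close> and touching it at the weak limit is bounded. With \<open>p\<close> the norm of the negative
part the set is the positive cone; with \<open>p\<close> the distance to a subspace it is the norm closure of
that subspace (Mazur's theorem).\<close>

lemma weak_limit_sublinear_le_0:
  fixes x :: "'i \<Rightarrow> 'a::real_normed_vector"
  assumes p: "sublinear p" "\<And>x. p x \<le> norm x"
    and "F \<noteq> bot" "weakly_tendsto x l F" "\<forall>\<^sub>F i in F. p (x i) \<le> 0"
  shows "p l \<le> 0"
proof -
  obtain f where f: "linear f" "\<And>x. f x \<le> p x" "f l = p l"
    using hahn_banach_dominated[OF p(1)] by blast
  have "\<bar>f y\<bar> \<le> norm y * 1" for y
    using f(2)[of y] f(2)[of "- y"] p(2)[of y] p(2)[of "- y"] linear_neg[OF f(1), of y] by simp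
  then have "bounded_linear f"
    using f(1) by (intro bounded_linear_intro[of _ 1]) (auto simp: linear_add linear_scale)
  then have "((\<lambda>i. f (x i)) \<longlongrightarrow> f l) F" using assms(4) by (simp add: weakly_tendsto_def)
  moreover have "\<forall>\<^sub>F i in F. f (x i) \<le> 0"
    using assms(5) by eventually_elim (use f(2) order_trans in blast)
  ultimately show ?thesis
    using assms(3) f(3) tendsto_upperbound by metis
qed

lemma weak_limit_nonneg:
  fixes x :: "'i \<Rightarrow> 'a::banach_lattice"
  assumes "F \<noteq> bot" "weakly_tendsto x l F" "\<forall>\<^sub>F i in F. 0 \<le> x i"
  shows "0 \<le> l"
proof -
  let ?p = "\<lambda>x::'a. norm (sup (- x) 0)"
  have "?p l \<le> 0"
  proof (rule weak_limit_sublinear_le_0[OF _ _ assms(1,2)])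
    have "?p (x + y) \<le> ?p x + ?p y" for x y
    proof -
      have "sup (- (x + y)) 0 \<le> sup (- x) 0 + sup (- y) 0"
      proof (rule sup_least)
        have "- (x + y) = - x + - y" by simp
        also have "\<dots> \<le> sup (- x) 0 + sup (- y) 0" by (intro add_mono) auto
        finally show "- (x + y) \<le> sup (- x) 0 + sup (- y) 0" .
      qed simp
      then have "?p (x + y) \<le> norm (sup (- x) 0 + sup (- y) 0)"
        by (intro norm_mono_nonneg) auto
      then show ?thesis using norm_triangle_ineq order_trans by blast
    qed
    moreover have "?p (c *\<^sub>R x) = c * ?p x" if "0 \<le> c" for c x
      using scaleR_sup[OF that, of "- x" 0] that
      by (metis abs_of_nonneg norm_scaleR scaleR_minus_right scaleR_zero_right)
    ultimately show "sublinear ?p" by (simp add: sublinear_def)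
    show "?p x \<le> norm x" for x
      using norm_mono_nonneg[of "sup (- x) 0" "\<bar>x\<bar>"] by (simp add: abs_ge_minus_self)
    show "\<forall>\<^sub>F i in F. ?p (x i) \<le> 0" using assms(3) by eventually_elim (simp add: sup_absorb2)
  qed
  then show ?thesis by (simp add: le_iff_sup[of "- l" 0, symmetric, simplified])
qed

lemma infdist_subspace_sublinear:
  fixes M :: "'a::real_normed_vector set"
  assumes M: "subspace M"
  shows "sublinear (\<lambda>x. infdist x M)"
  unfolding sublinear_def
proof (intro conjI allI impI)
  have ne: "M \<noteq> {}" using subspace_0[OF M] by blast
  have near: "\<exists>v\<in>M. norm (x - v) < infdist x M + \<epsilon>" if "0 < \<epsilon>" for x \<epsilon>
  proof -
    have "(INF v\<in>M. dist x v) < infdist x M + \<epsilon>"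
      using that ne by (simp add: infdist_notempty)
    then show ?thesis
      using ne by (subst (asm) cINF_less_iff) (auto simp: dist_norm intro: bdd_belowI2[of _ 0])
  qed
  show "infdist (x + y) M \<le> infdist x M + infdist y M" for x y
  proof (rule field_le_epsilon)
    fix \<epsilon> :: real assume "0 < \<epsilon>"
    then obtain v w where v: "v \<in> M" "norm (x - v) < infdist x M + \<epsilon> / 2"
      and w: "w \<in> M" "norm (y - w) < infdist y M + \<epsilon> / 2"
      using near[of "\<epsilon> / 2"] by (meson half_gt_zero)
    have "infdist (x + y) M \<le> dist (x + y) (v + w)"
      by (intro infdist_le subspace_add[OF M] v w)
    also have "\<dots> \<le> norm (x - v) + norm (y - w)"
      using norm_triangle_ineq[of "x - v" "y - w"] by (simp add: dist_norm algebra_simps)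
    finally show "infdist (x + y) M \<le> infdist x M + infdist y M + \<epsilon>" using v w by simp
  qed
  have le: "infdist (c *\<^sub>R x) M \<le> c * infdist x M" if "0 < c" for c x
  proof (rule field_le_epsilon)
    fix \<epsilon> :: real assume "0 < \<epsilon>"
    then obtain v where v: "v \<in> M" "norm (x - v) < infdist x M + \<epsilon> / c"
      using near[of "\<epsilon> / c" x] divide_pos_pos[of \<epsilon> c] \<open>0 < \<epsilon>\<close> \<open>0 < c\<close> by blast
    have "infdist (c *\<^sub>R x) M \<le> dist (c *\<^sub>R x) (c *\<^sub>R v)"
      by (intro infdist_le subspace_scale[OF M] v)
    also have "\<dots> = c * norm (x - v)" using that by (simp add: dist_norm flip: scaleR_diff_right)
    also have "\<dots> \<le> c * (infdist x M + \<epsilon> / c)" using that v by (intro mult_left_mono) auto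
    finally show "infdist (c *\<^sub>R x) M \<le> c * infdist x M + \<epsilon>" using that by (simp add: distrib_left)
  qed
  fix c :: real and x :: 'a assume "0 \<le> c"
  show "infdist (c *\<^sub>R x) M = c * infdist x M"
  proof (cases "c = 0")
    case True
    then show ?thesis using subspace_0[OF M] by simp
  next
    case False
    then show ?thesis
      using \<open>0 \<le> c\<close> le[of c x] le[of "1 / c" "c *\<^sub>R x"] by (simp add: field_simps)
  qed
qed

lemma weak_limit_in_closure_subspace:
  fixes x :: "'i \<Rightarrow> 'a::real_normed_vector"
  assumes M: "subspace M" and "F \<noteq> bot" "weakly_tendsto x l F" "\<forall>\<^sub>F i in F. x i \<in> M"
  shows "l \<in> closure M"
proof -
  have ne: "M \<noteq> {}" using subspace_0[OF M] by blast
  have "infdist l M \<le> 0"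
  proof (rule weak_limit_sublinear_le_0[OF infdist_subspace_sublinear[OF M] _ assms(2,3)])
    show "infdist x M \<le> norm x" for x
      using infdist_le[OF subspace_0[OF M], of x] by simp
    show "\<forall>\<^sub>F i in F. infdist (x i) M \<le> 0" using assms(4) by eventually_elim simp
  qed
  then show ?thesis using in_closure_iff_infdist_zero[OF ne] infdist_nonneg[of l M] by (metis antisym)
qed

section \<open>Order continuous norms\<close>

text \<open>The differences \<open>u - x n\<close>, over all upper bounds \<open>u\<close> of the sequence and all \<open>n\<close>, form a
downward directed net. If \<open>v \<ge> 0\<close> lies below all of them, then \<open>u - v\<close> is again an upper bound whenever
\<open>u\<close> is; iterating, \<open>b - k v\<close> is an upper bound for every \<open>k\<close>, and \<open>v = 0\<close> by the Archimedean property.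
So the net decreases to zero, order continuity makes it norm null, and \<open>u - x N\<close> dominates
\<open>x n - x N\<close> for \<open>n \<ge> N\<close>. In particular the limit is a supremum whose existence was not presupposed.\<close>

lemma order_continuous_incseq_convergent:
  fixes x :: "nat \<Rightarrow> 'a::banach_lattice"
  assumes oc: "order_continuous_norm TYPE('a)" and inc: "incseq x" and bound: "\<And>n. x n \<le> b"
  shows "convergent x"
proof -
  define B where "B = {u. \<forall>n. x n \<le> u} \<times> (UNIV :: nat set)"
  define r where "r p q \<longleftrightarrow> fst q \<le> fst p \<and> snd p \<le> snd q" for p q :: "'a \<times> nat"
  define y where "y p = fst p - x (snd p)" for p :: "'a \<times> nat"
  have dir: "directed_set B r"
    unfolding directed_set_def
  proof (intro conjI ballI impI)
    show "B \<noteq> {}" using bound by (auto simp: B_def)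
    fix p q assume "p \<in> B" "q \<in> B"
    then show "\<exists>c\<in>B. r p c \<and> r q c"
      by (intro bexI[of _ "(inf (fst p) (fst q), max (snd p) (snd q))"]) (auto simp: B_def r_def)
  qed (auto simp: r_def)
  have "net_decreases_to_zero B r y"
    unfolding net_decreases_to_zero_def
  proof (intro conjI ballI impI allI)
    show "y q \<le> y p" if "r p q" for p q
      using that incseqD[OF inc] by (auto simp: r_def y_def intro!: diff_mono)
    show "0 \<le> y p" if "p \<in> B" for p using that by (auto simp: B_def y_def)
    fix l assume l: "\<forall>p\<in>B. l \<le> y p"
    define v where "v = sup l 0"
    have v: "v \<le> u - x n" if "\<And>n. x n \<le> u" for u n
      using l that by (auto simp: v_def B_def y_def)
    have "x n \<le> b - real k *\<^sub>R v" for k n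
    proof (induction k arbitrary: n)
      case (Suc k)
      from v[OF this] have "v + x n \<le> b - real k *\<^sub>R v" by (simp add: le_diff_eq)
      then show ?case by (simp add: algebra_simps)
    qed (use bound in simp)
    then have "real k *\<^sub>R v \<le> b - x 0" for k
      by (metis add.commute le_diff_eq)
    moreover have "0 \<le> v" by (simp add: v_def)
    ultimately have "v = 0" using archimedean_eq_0 by blast
    then show "l \<le> 0" by (metis v_def sup_ge1)
  qed (rule dir)
  moreover have "\<forall>\<^sub>F q in net_filter B r. \<bar>y q - 0\<bar> \<le> y p" if "p \<in> B" for p
    unfolding eventually_net_filter[OF dir]
    using calculation that by (intro bexI[of _ p]) (auto simp: net_decreases_to_zero_def)
  ultimately have "order_tendsto y 0 (net_filter B r)" by (rule order_tendstoI)
  then have lim: "(y \<longlongrightarrow> 0) (net_filter B r)" by (rule order_continuous_normD[OF oc])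
  have "Cauchy x"
  proof (rule metric_CauchyI)
    fix \<epsilon> :: real assume "0 < \<epsilon>"
    then have "\<forall>\<^sub>F q in net_filter B r. norm (y q) < \<epsilon> / 2"
      using lim by (auto simp: tendsto_iff dest!: spec[of _ "\<epsilon> / 2"])
    then obtain u N where u: "\<And>n. x n \<le> u" "norm (u - x N) < \<epsilon> / 2"
      unfolding eventually_net_filter[OF dir] by (force simp: B_def y_def r_def)
    have near: "norm (x n - x N) < \<epsilon> / 2" if "N \<le> n" for n
    proof -
      have "norm (x n - x N) \<le> norm (u - x N)"
        using incseqD[OF inc that] u(1) by (intro norm_mono_nonneg) (auto intro: diff_right_mono)
      then show ?thesis using u(2) by simp
    qed
    have "dist (x m) (x n) < \<epsilon>" if "N \<le> m" "N \<le> n" for m n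
      using near[OF that(1)] near[OF that(2)] norm_triangle_ineq4[of "x m - x N" "x n - x N"]
      by (simp add: dist_norm)
    then show "\<exists>M. \<forall>m\<ge>M. \<forall>n\<ge>M. dist (x m) (x n) < \<epsilon>" by blast
  qed
  then show ?thesis by (rule Cauchy_convergent)
qed

lemma incseq_le_limit:
  fixes x :: "nat \<Rightarrow> 'a::banach_lattice"
  assumes "incseq x" "x \<longlonglongrightarrow> l"
  shows "x n \<le> l"
  by (rule tendsto_le_lattice[OF _ tendsto_const assms(2)])
    (auto intro: eventually_mono[OF eventually_ge_at_top[of n]] incseqD[OF assms(1)])

lemma limit_le_bound:
  fixes x :: "nat \<Rightarrow> 'a::banach_lattice"
  assumes "x \<longlonglongrightarrow> l" "\<And>n. x n \<le> b"
  shows "l \<le> b"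
  by (rule tendsto_le_lattice[OF _ assms(1) tendsto_const]) (use assms(2) in auto)

section \<open>Band projections\<close>

text \<open>The projection of \<open>x\<close> onto the band generated by \<open>u\<close>. The formula gives that projection only for
non-negative \<open>x\<close> and \<open>u\<close>; the positive cone is all that the maximal inequality needs, which spares
the linear extension.\<close>

definition band_proj :: "'a::banach_lattice \<Rightarrow> 'a \<Rightarrow> 'a" where
  "band_proj u x = lim (\<lambda>k. inf x (real k *\<^sub>R u))"

lemma incseq_inf_multiples: "0 \<le> u \<Longrightarrow> incseq (\<lambda>k. inf x (real k *\<^sub>R u))"
  for u x :: "'a::banach_lattice"
  unfolding incseq_def by (intro allI impI inf_mono scaleR_right_mono) auto

text \<open>The type token only transports the hypothesis on the norm to the carrier type.\<close>

locale order_continuous_lattice =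
  fixes dummy :: "'a::banach_lattice itself"
  assumes order_continuous: "order_continuous_norm TYPE('a)"
begin

lemma band_proj_lim:
  fixes u x :: 'a
  assumes "0 \<le> u"
  shows "(\<lambda>k. inf x (real k *\<^sub>R u)) \<longlonglongrightarrow> band_proj u x"
  unfolding band_proj_def
  by (intro convergent_LIMSEQ_iff[THEN iffD1]
      order_continuous_incseq_convergent[OF order_continuous incseq_inf_multiples[OF assms]])
    (rule inf_le1)

lemma inf_multiple_le_band_proj:
  fixes u x :: 'a
  assumes "0 \<le> u"
  shows "inf x (real k *\<^sub>R u) \<le> band_proj u x"
  using incseq_le_limit[OF incseq_inf_multiples[OF assms] band_proj_lim[OF assms]] .

lemma band_proj_le: "0 \<le> u \<Longrightarrow> band_proj u x \<le> x" for u x :: 'a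
  by (rule limit_le_bound[OF band_proj_lim]) auto

lemma band_proj_nonneg: "0 \<le> u \<Longrightarrow> 0 \<le> x \<Longrightarrow> 0 \<le> band_proj u x" for u x :: 'a
  using inf_multiple_le_band_proj[of u x 0] by (simp add: inf_absorb2)

text \<open>Both inequalities hold before passing to the limit, at the price of doubling the multiple of \<open>u\<close>
in one of them.\<close>

lemma band_proj_add:
  fixes u x y :: 'a
  assumes u: "0 \<le> u" and x: "0 \<le> x" and y: "0 \<le> y"
  shows "band_proj u (x + y) = band_proj u x + band_proj u y"
proof (rule antisym)
  show "band_proj u (x + y) \<le> band_proj u x + band_proj u y"
  proof (rule limit_le_bound[OF band_proj_lim[OF u]])
    fix k
    have "inf (x + y) (real k *\<^sub>R u) \<le> inf x (real k *\<^sub>R u) + inf y (real k *\<^sub>R u)"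
      using assms by (intro inf_add_le scaleR_nonneg_nonneg) auto
    also have "\<dots> \<le> band_proj u x + band_proj u y"
      by (intro add_mono inf_multiple_le_band_proj u)
    finally show "inf (x + y) (real k *\<^sub>R u) \<le> band_proj u x + band_proj u y" .
  qed
  show "band_proj u x + band_proj u y \<le> band_proj u (x + y)"
  proof (rule limit_le_bound[OF tendsto_add[OF band_proj_lim band_proj_lim, OF u u]])
    fix k
    have "inf x (real k *\<^sub>R u) + inf y (real k *\<^sub>R u) \<le> inf (x + y) (real (k + k) *\<^sub>R u)"
      unfolding of_nat_add scaleR_left_distrib by (intro inf_greatest add_mono inf_le1 inf_le2)
    also have "\<dots> \<le> band_proj u (x + y)" by (rule inf_multiple_le_band_proj[OF u])
    finally show "inf x (real k *\<^sub>R u) + inf y (real k *\<^sub>R u) \<le> band_proj u (x + y)" .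
  qed
qed

lemma band_proj_disjoint:
  fixes u y :: 'a
  assumes "0 \<le> u" "0 \<le> y" "inf y u = 0"
  shows "band_proj u y = 0"
  unfolding band_proj_def using assms by (simp add: disjoint_scaleR)

text \<open>Enlarging the band by elements disjoint from \<open>y\<close> does not change the projection of \<open>y\<close>. The bound
\<open>sup u v \<le> u + v\<close> reduces this to subadditivity of truncation.\<close>

lemma band_proj_sup_disjoint:
  fixes u v y :: 'a
  assumes "0 \<le> u" "0 \<le> v" "0 \<le> y" "inf y v = 0"
  shows "band_proj (sup u v) y = band_proj u y"
proof -
  have "inf y (real k *\<^sub>R sup u v) = inf y (real k *\<^sub>R u)" for k
  proof (rule antisym)
    have k: "0 \<le> real k *\<^sub>R u" "0 \<le> real k *\<^sub>R v"
      using assms by (simp_all add: scaleR_nonneg_nonneg)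
    have "real k *\<^sub>R sup u v \<le> real k *\<^sub>R u + real k *\<^sub>R v"
      using k by (simp add: scaleR_sup add_increasing add_increasing2)
    then have "inf y (real k *\<^sub>R sup u v) \<le> inf (real k *\<^sub>R u + real k *\<^sub>R v) y"
      by (simp add: le_infI2)
    also have "\<dots> \<le> inf (real k *\<^sub>R u) y + inf (real k *\<^sub>R v) y"
      using k assms by (intro inf_add_le)
    also have "\<dots> = inf y (real k *\<^sub>R u)"
      using disjoint_scaleR[OF assms(3,2,4), of k] by (simp add: inf_commute)
    finally show "inf y (real k *\<^sub>R sup u v) \<le> inf y (real k *\<^sub>R u)" .
    show "inf y (real k *\<^sub>R u) \<le> inf y (real k *\<^sub>R sup u v)"
      by (intro inf_mono scaleR_left_mono) auto
  qed
  then show ?thesis by (simp add: band_proj_def)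
qed

lemma band_proj_mono_band:
  fixes u v x :: 'a
  assumes "0 \<le> u" "u \<le> v"
  shows "band_proj u x \<le> band_proj v x"
proof (rule limit_le_bound[OF band_proj_lim[OF assms(1)]])
  fix k
  have "inf x (real k *\<^sub>R u) \<le> inf x (real k *\<^sub>R v)"
    using assms by (intro inf_mono scaleR_left_mono) auto
  also have "\<dots> \<le> band_proj v x"
    by (rule inf_multiple_le_band_proj) (use assms in \<open>rule order_trans\<close>)
  finally show "inf x (real k *\<^sub>R u) \<le> band_proj v x" .
qed

text \<open>An element \<open>v\<close> below both \<open>x - band_proj u x\<close> and \<open>u\<close> can be added to each truncation
\<open>inf x (k u)\<close> without leaving the next one, so in the limit \<open>v + band_proj u x \<le> band_proj u x\<close>.\<close>

lemma band_proj_complement_disjoint: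
  fixes u x :: 'a
  assumes u: "0 \<le> u"
  shows "inf (x - band_proj u x) u = 0"
proof (rule antisym)
  define v where "v = inf (x - band_proj u x) u"
  have "v + inf x (real k *\<^sub>R u) \<le> band_proj u x" for k
  proof -
    have "v + inf x (real k *\<^sub>R u) \<le> (x - band_proj u x) + band_proj u x"
      by (intro add_mono inf_multiple_le_band_proj u) (simp add: v_def)
    moreover have "v + inf x (real k *\<^sub>R u) \<le> u + real k *\<^sub>R u"
      by (intro add_mono) (simp_all add: v_def)
    ultimately have "v + inf x (real k *\<^sub>R u) \<le> inf x (real (Suc k) *\<^sub>R u)"
      by (simp add: algebra_simps)
    also have "\<dots> \<le> band_proj u x" by (rule inf_multiple_le_band_proj[OF u])
    finally show ?thesis .
  qed
  then have "v + band_proj u x \<le> band_proj u x"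
    by (intro limit_le_bound[OF tendsto_add[OF tendsto_const band_proj_lim[OF u]]])
  then show "inf (x - band_proj u x) u \<le> 0" by (simp add: v_def)
  show "0 \<le> inf (x - band_proj u x) u" using u band_proj_le[OF u] by simp
qed

end

section \<open>Conditional expectations and band projections\<close>

text \<open>In the model case \<open>E n\<close> is the conditional expectation given the \<open>n\<close>-th member of an increasing
family of sigma-algebras on a probability space, \<open>e\<close> is the constant function 1 and \<open>\<phi>\<close> is the integral.\<close>

locale bistochastic_filtration = order_continuous_lattice dummy
  for dummy :: "'a::banach_lattice itself" +
  fixes E :: "nat \<Rightarrow> 'a \<Rightarrow> 'a" and e :: 'a and \<phi> :: "'a \<Rightarrow> real"
  assumes bounded: "bounded_filtration E"
    and unit: "weak_unit e"
    and strict: "strictly_positive_functional \<phi>"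
    and E1_unit: "E 1 e = e"
    and functional_E1: "\<phi> \<circ> E 1 = \<phi>"
begin

lemma bounded_linear_E: "1 \<le> n \<Longrightarrow> bounded_linear (E n)"
  using bounded by (simp add: bounded_filtration_def)

lemma linear_E: "1 \<le> n \<Longrightarrow> linear (E n)"
  using bounded_linear_E bounded_linear.linear by blast

lemma E_nonneg: "1 \<le> n \<Longrightarrow> 0 \<le> x \<Longrightarrow> 0 \<le> E n x"
  using bounded by (simp add: bounded_filtration_def filtration_def)

lemma E_mono:
  assumes "1 \<le> n" "x \<le> y"
  shows "E n x \<le> E n y"
  using E_nonneg[of n "y - x"] assms by (simp add: linear_diff[OF linear_E])

lemma E_E:
  assumes "1 \<le> n" "1 \<le> m"
  shows "E n (E m x) = E (min m n) x"
proof -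
  have "E n \<circ> E m = E (min m n)"
    using bounded assms by (simp add: bounded_filtration_def filtration_def)
  then show ?thesis by (metis comp_apply)
qed

lemma E_fixed_mono:
  assumes "1 \<le> m" "m \<le> n" "E m x = x"
  shows "E n x = x"
  using E_E[of n m x] assms by (simp add: min_absorb1)

lemma E_unit: "1 \<le> n \<Longrightarrow> E n e = e"
  using E_fixed_mono[of 1 n e] E1_unit by simp

lemma functional_E: "1 \<le> n \<Longrightarrow> \<phi> (E n x) = \<phi> x"
  using E_E[of 1 n x] functional_E1 by (metis comp_apply min_absorb2 order_refl)

lemma functional_linear: "linear \<phi>"
  and functional_nonneg: "0 \<le> x \<Longrightarrow> 0 \<le> \<phi> x"
  using strict by (auto simp: strictly_positive_functional_def)

lemma functional_eq_0: "0 \<le> x \<Longrightarrow> \<phi> x = 0 \<Longrightarrow> x = 0"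
  using strict unfolding strictly_positive_functional_def by (metis order_less_le)

lemma functional_mono: "x \<le> y \<Longrightarrow> \<phi> x \<le> \<phi> y"
  using functional_nonneg[of "y - x"] by (simp add: linear_diff[OF functional_linear])

lemma functional_tendsto: "(f \<longlongrightarrow> l) F \<Longrightarrow> ((\<lambda>i. \<phi> (f i)) \<longlongrightarrow> \<phi> l) F"
  using bounded_linear.tendsto positive_functional_bounded_linear functional_linear functional_nonneg
  by metis

text \<open>The range of \<open>E n\<close> is a sublattice: \<open>inf a b - E n (inf a b)\<close> is non-negative and \<open>\<phi>\<close> vanishes
at it, so it is zero by strict positivity.\<close>

lemma E_fixed_inf:
  assumes n: "1 \<le> n" and "E n a = a" "E n b = b"
  shows "E n (inf a b) = inf a b"
proof -
  have "E n (inf a b) \<le> inf a b"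
    using E_mono[OF n inf_le1[of a b]] E_mono[OF n inf_le2[of a b]] assms by simp
  then show ?thesis
    using functional_eq_0[of "inf a b - E n (inf a b)"] functional_E[OF n]
    by (simp add: linear_diff[OF functional_linear])
qed

lemma E_fixed_sup:
  assumes n: "1 \<le> n" and "E n a = a" "E n b = b"
  shows "E n (sup a b) = sup a b"
  using E_fixed_inf[OF n, of "- a" "- b"] assms linear_neg[OF linear_E[OF n]]
  by (metis neg_equal_iff_equal neg_sup_eq_inf)

lemma unit_nonneg: "0 \<le> e"
  using unit by (simp add: weak_unit_def order_less_imp_le)

lemma band_proj_unit:
  assumes "0 \<le> x"
  shows "band_proj e x = x"
proof (rule antisym[OF band_proj_le[OF unit_nonneg]])
  show "x \<le> band_proj e x"
    using unit assms inf_multiple_le_band_proj[OF unit_nonneg] by (simp add: weak_unit_def)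
qed

lemma disjoint_unit: "0 \<le> x \<Longrightarrow> inf x e = 0 \<Longrightarrow> x = 0"
  using band_proj_disjoint[OF unit_nonneg] band_proj_unit by metis

text \<open>For conditional expectations this is immediate from pulling out the measurable factor \<open>u\<close>. Without
a product, the argument first truncates \<open>z\<close> by a multiple \<open>g\<close> of the weak unit. The truncation is disjoint
from \<open>inf g (j u)\<close>, hence their sum is their supremum and stays below \<open>g\<close>; applying \<open>E n\<close>,
which fixes \<open>g\<close> and \<open>u\<close>, gives \<open>E n (inf z g) + inf g (j u) \<le> g\<close>. An element \<open>v\<close> below both \<open>E n (inf z g)\<close>
and \<open>u\<close> therefore satisfies \<open>j v \<le> g\<close> for all \<open>j\<close> by induction, so \<open>v = 0\<close>.\<close>

lemma E_disjoint:
  assumes n: "1 \<le> n" and z: "0 \<le> z" and u: "0 \<le> u" "E n u = u" and disj: "inf z u = 0"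
  shows "inf (E n z) u = 0"
proof -
  have *: "inf (E n (inf z (real k *\<^sub>R e))) u = 0" for k
  proof -
    define g where "g = real k *\<^sub>R e"
    define v where "v = inf (E n (inf z g)) u"
    have g: "0 \<le> g" "E n g = g"
      using unit_nonneg E_unit[OF n] by (simp_all add: g_def scaleR_nonneg_nonneg linear_scale[OF linear_E[OF n]])
    have Eu: "E n (real j *\<^sub>R u) = real j *\<^sub>R u" for j
      using u by (simp add: linear_scale[OF linear_E[OF n]])
    have le_g: "E n (inf z g) + inf g (real j *\<^sub>R u) \<le> g" for j
    proof -
      have "inf (inf z g) (inf g (real j *\<^sub>R u)) \<le> inf z (real j *\<^sub>R u)"
        by (intro inf_mono inf_le1 inf_le2)
      also have "\<dots> = 0" by (rule disjoint_scaleR[OF z u(1) disj])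
      finally have "inf (inf z g) (inf g (real j *\<^sub>R u)) = 0"
        using z g u by (intro antisym) (simp_all add: scaleR_nonneg_nonneg)
      then have "inf z g + inf g (real j *\<^sub>R u) \<le> g"
        by (simp add: add_disjoint_eq_sup)
      then have "E n (inf z g + inf g (real j *\<^sub>R u)) \<le> E n g" by (rule E_mono[OF n])
      then show ?thesis
        by (simp add: linear_add[OF linear_E[OF n]] E_fixed_inf[OF n g(2) Eu] g)
    qed
    have "real j *\<^sub>R v \<le> g" for j
    proof (induction j)
      case (Suc j)
      have "real j *\<^sub>R v \<le> real j *\<^sub>R u" by (intro scaleR_left_mono) (simp_all add: v_def)
      with Suc have "v + real j *\<^sub>R v \<le> E n (inf z g) + inf g (real j *\<^sub>R u)"
        by (intro add_mono) (simp_all add: v_def)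
      also have "\<dots> \<le> g" by (rule le_g)
      finally show ?case by (simp add: algebra_simps)
    qed (use g in simp)
    moreover have "0 \<le> v" using z g u by (simp add: v_def E_nonneg[OF n])
    ultimately have "v = 0" using archimedean_eq_0 by blast
    then show ?thesis by (simp add: v_def g_def)
  qed
  have "(\<lambda>k. inf (E n (inf z (real k *\<^sub>R e))) u) \<longlonglongrightarrow> inf (E n z) u"
    using band_proj_lim[OF unit_nonneg, of z] band_proj_unit[OF z]
    by (intro tendsto_inf_const bounded_linear.tendsto[OF bounded_linear_E[OF n]]) simp
  then show ?thesis using LIMSEQ_unique[OF tendsto_const[of 0]] by (simp add: *)
qed

text \<open>This is the averaging property in the form needed: projections onto bands generated by elements of
the range of \<open>E n\<close> play the part of indicators of measurable sets. The part of \<open>x\<close> disjoint from \<open>u\<close>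
stays disjoint from \<open>u\<close> under \<open>E n\<close>.\<close>

lemma band_proj_E_le:
  assumes n: "1 \<le> n" and u: "0 \<le> u" "E n u = u" and x: "0 \<le> x"
  shows "band_proj u (E n x) \<le> E n (band_proj u x)"
proof -
  let ?r = "x - band_proj u x"
  have r: "0 \<le> ?r" using band_proj_le[OF u(1)] by simp
  have "band_proj u (E n x) = band_proj u (E n (band_proj u x) + E n ?r)"
    by (simp flip: linear_add[OF linear_E[OF n]])
  also have "\<dots> = band_proj u (E n (band_proj u x)) + band_proj u (E n ?r)"
    by (intro band_proj_add E_nonneg n u r band_proj_nonneg x)
  also have "band_proj u (E n ?r) = 0"
    by (intro band_proj_disjoint E_disjoint E_nonneg n u r band_proj_complement_disjoint)
  finally show ?thesis using band_proj_le[OF u(1)] by simp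
qed

section \<open>The maximal inequality\<close>

text \<open>Starting from 0 keeps the supremum over an empty range meaningful and non-negative, so no sign
condition on \<open>f\<close> enters the estimates.\<close>

primrec running_sup :: "(nat \<Rightarrow> 'a) \<Rightarrow> nat \<Rightarrow> 'a" where
  "running_sup f 0 = 0"
| "running_sup f (Suc k) = sup (running_sup f k) (f k)"

lemma running_sup_nonneg: "0 \<le> running_sup f M"
  by (induction M) (auto intro: le_supI1)

lemma running_sup_upper: "k < M \<Longrightarrow> f k \<le> running_sup f M"
  by (induction M) (auto simp: less_Suc_eq intro: le_supI1)

lemma running_sup_least: "0 \<le> b \<Longrightarrow> (\<And>k. k < M \<Longrightarrow> f k \<le> b) \<Longrightarrow> running_sup f M \<le> b"
  by (induction M) auto

lemma running_sup_mono: "(\<And>k. k < M \<Longrightarrow> f k \<le> g k) \<Longrightarrow> running_sup f M \<le> running_sup g M"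
  by (rule running_sup_least) (auto intro: running_sup_nonneg order_trans running_sup_upper)

lemma running_sup_add: "running_sup (\<lambda>k. f k + g k) M \<le> running_sup f M + running_sup g M"
  by (rule running_sup_least) (auto intro: add_mono running_sup_upper add_nonneg_nonneg running_sup_nonneg)

lemma incseq_running_sup: "incseq (running_sup f)"
  by (rule incseq_SucI) simp

text \<open>Doob's maximal inequality for the supermartingale \<open>d\<close> at level \<open>c\<close>. The projection \<open>band_proj (u k)\<close>
stands for the event that one of \<open>d 0\<close>, ..., \<open>d (k - 1)\<close> has exceeded \<open>c\<close>; on it the value \<open>c\<close> is collected,
and off it \<open>d k\<close> is still held. Passing from \<open>k\<close> to \<open>Suc k\<close>, the part newly stopped has
\<open>d k \<ge> c e\<close>, so that exchanging \<open>d k\<close> for \<open>c e\<close> there does not increase the value of \<open>\<phi>\<close>; on the rest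
\<open>d k\<close> is replaced by \<open>d (Suc k)\<close>, and the supermartingale property applies because the new band is
generated by an element of the range of \<open>E (m + k)\<close>.\<close>

lemma doob_band_inequality:
  assumes m: "1 \<le> m" and c: "0 < c"
    and adapted: "\<And>k. E (m + k) (d k) = d k" and nonneg: "\<And>k. 0 \<le> d k"
    and super: "\<And>k. E (m + k) (d (Suc k)) \<le> d k"
  defines "u \<equiv> \<lambda>k. sup (running_sup d k - c *\<^sub>R e) 0"
  shows "\<phi> (band_proj (u k) (c *\<^sub>R e)) + \<phi> (d k - band_proj (u k) (d k)) \<le> \<phi> (d 0)"
proof (induction k)
  have ce: "0 \<le> c *\<^sub>R e" using c unit_nonneg by (simp add: scaleR_nonneg_nonneg)
  {
    case 0
    have "u 0 = 0" using ce by (simp add: u_def sup_absorb2)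
    then have "band_proj (u 0) x = 0" if "0 \<le> x" for x
      using band_proj_disjoint[of 0 x] that by (simp add: inf_absorb2)
    then show ?case using ce nonneg by (simp add: linear_0[OF functional_linear])
  next
    case (Suc k)
    have mk: "1 \<le> m + k" using m by simp
    note lin = linear_add[OF functional_linear] linear_diff[OF functional_linear]
    define P0 where "P0 = band_proj (u k)"
    define P where "P = band_proj (u (Suc k))"
    define v where "v = sup (d k - c *\<^sub>R e) 0"
    define y where "y = sup (c *\<^sub>R e - d k) 0"
    have u0: "0 \<le> u j" for j by (simp add: u_def)
    have pos: "0 \<le> v" "0 \<le> y" by (simp_all add: v_def y_def)
    have u_Suc: "u (Suc k) = sup (u k) v"
      unfolding u_def v_def running_sup.simps diff_conv_add_uminus add_sup_distrib_right
      by (simp add: sup_aci)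
    have y_eq: "y = v - (d k - c *\<^sub>R e)"
      unfolding y_def v_def by (simp add: diff_conv_add_uminus add_sup_distrib_right sup_commute del: add_uminus_conv_diff)
    then have decomp: "d k + y = c *\<^sub>R e + v" by simp
    have "inf y v = 0"
    proof -
      have "inf y v = v + inf (- (d k - c *\<^sub>R e)) 0"
        unfolding y_eq by (simp only: add_inf_distrib_left add_0_right add_uminus_conv_diff)
      also have "inf (- (d k - c *\<^sub>R e)) 0 = - v"
        unfolding v_def by (simp only: neg_sup_eq_inf minus_zero)
      finally show ?thesis by simp
    qed
    then have Py: "P y = P0 y"
      unfolding P_def P0_def u_Suc by (intro band_proj_sup_disjoint u0 pos)
    have Pv: "P0 v \<le> P v"
      unfolding P_def P0_def by (rule band_proj_mono_band) (simp_all add: u0 u_Suc)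
    have "P (d k) + P y = P (c *\<^sub>R e) + P v" "P0 (d k) + P0 y = P0 (c *\<^sub>R e) + P0 v"
      using decomp pos ce nonneg[of k] u0 unfolding P_def P0_def by (metis band_proj_add)+
    then have "P (c *\<^sub>R e) + P0 (d k) + P v = P0 (c *\<^sub>R e) + P (d k) + P0 v"
      using Py by (metis add.assoc add.commute add_right_cancel)
    then have "\<phi> (P (c *\<^sub>R e)) + \<phi> (P0 (d k)) + \<phi> (P v) = \<phi> (P0 (c *\<^sub>R e)) + \<phi> (P (d k)) + \<phi> (P0 v)"
      by (metis lin(1))
    then have new_band: "\<phi> (P (c *\<^sub>R e)) + \<phi> (P0 (d k)) \<le> \<phi> (P0 (c *\<^sub>R e)) + \<phi> (P (d k))"
      using functional_mono[OF Pv] by linarith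
    have d_fixed: "E (m + k) (d j) = d j" if "j \<le> k" for j
      using E_fixed_mono[of "m + j" "m + k" "d j"] adapted[of j] m that by simp
    have S_fixed: "E (m + k) (running_sup d j) = running_sup d j" if "j \<le> Suc k" for j
      using that
    proof (induction j)
      case (Suc j)
      then show ?case using d_fixed[of j] by (simp add: E_fixed_sup[OF mk])
    qed (simp add: linear_0[OF linear_E[OF mk]])
    have u_fixed: "E (m + k) (u (Suc k)) = u (Suc k)"
      unfolding u_def using S_fixed[of "Suc k"]
      by (intro E_fixed_sup[OF mk])
        (simp_all add: linear_0[OF linear_E[OF mk]] linear_diff[OF linear_E[OF mk]]
          linear_scale[OF linear_E[OF mk]] E_unit[OF mk] del: running_sup.simps)
    define t where "t = E (m + k) (d (Suc k))"
    have t: "0 \<le> t" "t \<le> d k" using nonneg super by (simp_all add: t_def E_nonneg[OF mk])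
    have "\<phi> (P t) \<le> \<phi> (E (m + k) (P (d (Suc k))))"
      unfolding t_def P_def by (intro functional_mono band_proj_E_le mk u0 u_fixed nonneg)
    then have "\<phi> (d (Suc k) - P (d (Suc k))) \<le> \<phi> t - \<phi> (P t)"
      using functional_E[OF mk] by (simp add: lin t_def)
    also have "\<dots> \<le> \<phi> (d k) - \<phi> (P (d k))"
    proof -
      have "P (d k) = P t + P (d k - t)"
        unfolding P_def using band_proj_add[of "u (Suc k)" t "d k - t"] u0 t by simp
      then have "\<phi> (P (d k)) = \<phi> (P t) + \<phi> (P (d k - t))" by (simp add: lin)
      moreover have "\<phi> (P (d k - t)) \<le> \<phi> (d k - t)"
        unfolding P_def by (intro functional_mono band_proj_le u0)
      ultimately show ?thesis by (simp add: lin)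
    qed
    finally show ?case
      using new_band Suc.IH by (simp add: lin P_def P0_def)
  }
qed

text \<open>Truncation by \<open>e\<close> costs at most \<open>c e\<close> below the level \<open>c\<close>; above it, \<open>inf u e\<close> is dominated by
\<open>band_proj u (c e) / c\<close>.\<close>

lemma doob_maximal_inequality:
  assumes m: "1 \<le> m" and c: "0 < c"
    and adapted: "\<And>k. E (m + k) (d k) = d k" and nonneg: "\<And>k. 0 \<le> d k"
    and super: "\<And>k. E (m + k) (d (Suc k)) \<le> d k"
  shows "\<phi> (inf (running_sup d M) e) \<le> c * \<phi> e + \<phi> (d 0) / c"
proof -
  define u where "u = sup (running_sup d M - c *\<^sub>R e) 0"
  have u0: "0 \<le> u" by (simp add: u_def)
  have ce: "0 \<le> c *\<^sub>R e" using c unit_nonneg by (simp add: scaleR_nonneg_nonneg)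
  have "running_sup d M - c *\<^sub>R e \<le> u" by (simp add: u_def)
  then have "running_sup d M \<le> c *\<^sub>R e + u" by (simp add: diff_le_eq add.commute)
  then have "inf (running_sup d M) e \<le> inf (c *\<^sub>R e + u) e" by (intro inf_mono) auto
  also have "\<dots> \<le> inf (c *\<^sub>R e) e + inf u e" by (intro inf_add_le ce u0 unit_nonneg)
  also have "\<dots> \<le> c *\<^sub>R e + inf u e" by (intro add_mono) auto
  finally have "\<phi> (inf (running_sup d M) e) \<le> \<phi> (c *\<^sub>R e + inf u e)" by (rule functional_mono)
  also have "\<dots> = c * \<phi> e + \<phi> (inf u e)"
    by (simp add: linear_add[OF functional_linear] linear_scale[OF functional_linear])
  also have "\<phi> (inf u e) \<le> \<phi> (d 0) / c"
  proof -
    obtain k :: nat where k: "c \<le> real k" using real_arch_simple by blast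
    have "c *\<^sub>R inf u e = inf (c *\<^sub>R e) (c *\<^sub>R u)"
      using c by (simp add: scaleR_inf inf_commute)
    also have "\<dots> \<le> inf (c *\<^sub>R e) (real k *\<^sub>R u)"
      using k u0 by (intro inf_mono[OF order_refl] scaleR_right_mono)
    also have "\<dots> \<le> band_proj u (c *\<^sub>R e)" by (rule inf_multiple_le_band_proj[OF u0])
    finally have "\<phi> (c *\<^sub>R inf u e) \<le> \<phi> (band_proj u (c *\<^sub>R e))" by (rule functional_mono)
    moreover have "0 \<le> \<phi> (d M - band_proj u (d M))"
      using band_proj_le[OF u0] by (intro functional_nonneg) simp
    ultimately have "c * \<phi> (inf u e) \<le> \<phi> (d 0)"
      using doob_band_inequality[OF m c adapted nonneg super, of M, folded u_def]
      by (simp add: linear_scale[OF functional_linear])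
    then show ?thesis using c by (simp add: field_simps)
  qed
  finally show ?thesis by simp
qed

section \<open>Smallness of tail suprema and unbounded order convergence\<close>

text \<open>Abstract almost everywhere convergence to zero: the suprema over the tails converge to zero in
measure. It is phrased with finite suprema, since those of whole tails need not exist.\<close>

definition tail_sup_null :: "(nat \<Rightarrow> 'a) \<Rightarrow> bool" where
  "tail_sup_null f \<longleftrightarrow>
     (\<forall>\<epsilon>>0. \<forall>\<^sub>F N in sequentially. \<forall>M. \<phi> (inf (running_sup (\<lambda>k. f (N + k)) M) e) \<le> \<epsilon>)"

lemma tail_sup_null_add:
  assumes "tail_sup_null f" "tail_sup_null g"
  shows "tail_sup_null (\<lambda>n. f n + g n)"
  unfolding tail_sup_null_def
proof (intro allI impI)
  fix \<epsilon> :: real assume "0 < \<epsilon>"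
  then have "0 < \<epsilon> / 2" by simp
  with assms have
    "\<forall>\<^sub>F N in sequentially. \<forall>M. \<phi> (inf (running_sup (\<lambda>k. f (N + k)) M) e) \<le> \<epsilon> / 2"
    "\<forall>\<^sub>F N in sequentially. \<forall>M. \<phi> (inf (running_sup (\<lambda>k. g (N + k)) M) e) \<le> \<epsilon> / 2"
    unfolding tail_sup_null_def by blast+
  then show "\<forall>\<^sub>F N in sequentially. \<forall>M. \<phi> (inf (running_sup (\<lambda>k. f (N + k) + g (N + k)) M) e) \<le> \<epsilon>"
  proof eventually_elim
    case (elim N)
    show ?case
    proof
      fix M
      let ?F = "running_sup (\<lambda>k. f (N + k)) M" and ?G = "running_sup (\<lambda>k. g (N + k)) M"
      have "inf (running_sup (\<lambda>k. f (N + k) + g (N + k)) M) e \<le> inf (?F + ?G) e"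
        by (intro inf_mono running_sup_add order_refl)
      also have "\<dots> \<le> inf ?F e + inf ?G e"
        by (intro inf_add_le running_sup_nonneg unit_nonneg)
      finally have "\<phi> (inf (running_sup (\<lambda>k. f (N + k) + g (N + k)) M) e) \<le> \<phi> (inf ?F e + inf ?G e)"
        by (rule functional_mono)
      also have "\<dots> = \<phi> (inf ?F e) + \<phi> (inf ?G e)"
        by (rule linear_add[OF functional_linear])
      also have "\<dots> \<le> \<epsilon> / 2 + \<epsilon> / 2" using elim by (intro add_mono) auto
      finally show "\<phi> (inf (running_sup (\<lambda>k. f (N + k) + g (N + k)) M) e) \<le> \<epsilon>" by simp
    qed
  qed
qed

lemma tail_sup_null_mono:
  assumes "tail_sup_null g" "\<forall>\<^sub>F n in sequentially. f n \<le> g n"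
  shows "tail_sup_null f"
  unfolding tail_sup_null_def
proof (intro allI impI)
  fix \<epsilon> :: real assume "0 < \<epsilon>"
  obtain N0 where N0: "\<And>n. N0 \<le> n \<Longrightarrow> f n \<le> g n"
    using assms(2) by (auto simp: eventually_sequentially)
  have "\<forall>\<^sub>F N in sequentially. \<forall>M. \<phi> (inf (running_sup (\<lambda>k. g (N + k)) M) e) \<le> \<epsilon>"
    using assms(1) \<open>0 < \<epsilon>\<close> by (simp add: tail_sup_null_def)
  then show "\<forall>\<^sub>F N in sequentially. \<forall>M. \<phi> (inf (running_sup (\<lambda>k. f (N + k)) M) e) \<le> \<epsilon>"
    using eventually_ge_at_top[of N0]
  proof eventually_elim
    case (elim N)
    have "\<phi> (inf (running_sup (\<lambda>k. f (N + k)) M) e) \<le> \<phi> (inf (running_sup (\<lambda>k. g (N + k)) M) e)" for M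
      using elim(2) by (intro functional_mono inf_mono running_sup_mono order_refl N0) simp
    then show ?case using elim(1) order_trans by blast
  qed
qed

text \<open>After truncation by \<open>y\<close> the tail suprema \<open>G N\<close> exist as norm limits, and they decrease. A lower bound \<open>v \<ge> 0\<close>
of all of them has \<open>\<phi> (inf v e) = 0\<close>, hence \<open>inf v e = 0\<close> by strict positivity, and \<open>v = 0\<close>
since \<open>e\<close> is a weak unit.\<close>

lemma tail_sup_null_order_tendsto:
  assumes f: "tail_sup_null f" "\<forall>\<^sub>F n in sequentially. 0 \<le> f n" and y: "0 \<le> y"
  shows "order_tendsto (\<lambda>n. inf (f n) y) 0 sequentially"
proof (rule order_tendstoI)
  define S where "S N = running_sup (\<lambda>k. inf (f (N + k)) y)" for N
  define G where "G N = lim (S N)" for N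
  have S_le: "S N M \<le> y" for N M
    unfolding S_def by (rule running_sup_least[OF y]) simp
  have "convergent (S N)" for N
    by (rule order_continuous_incseq_convergent[OF order_continuous _ S_le])
      (simp add: S_def incseq_running_sup)
  then have S_lim: "S N \<longlonglongrightarrow> G N" for N by (simp add: G_def convergent_LIMSEQ_iff)
  have S_le_G: "S N M \<le> G N" for N M
    using incseq_le_limit[OF _ S_lim] by (simp add: S_def incseq_running_sup)
  have G0: "0 \<le> G N" for N
    using S_le_G[of N 0] by (simp add: S_def)
  have upper: "inf (f n) y \<le> G N" if "N \<le> n" for n N
    using running_sup_upper[of "n - N" "Suc (n - N)" "\<lambda>k. inf (f (N + k)) y"]
      S_le_G[of N "Suc (n - N)"] that by (auto simp: S_def intro: order_trans)
  have dec: "G N' \<le> G N" if "N \<le> N'" for N N'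
    by (rule limit_le_bound[OF S_lim]) (use that in \<open>auto simp: S_def intro!: running_sup_least G0 upper\<close>)
  show "net_decreases_to_zero (UNIV :: nat set) (\<le>) G"
    unfolding net_decreases_to_zero_def directed_set_def
  proof (intro conjI ballI impI allI)
    show "\<exists>c\<in>UNIV. a \<le> c \<and> b \<le> c" for a b :: nat by (intro bexI[of _ "max a b"]) auto
    fix l assume l: "\<forall>N\<in>UNIV. l \<le> G N"
    define v where "v = sup l 0"
    have v: "0 \<le> v" "v \<le> G N" for N using l G0 by (auto simp: v_def)
    have "\<phi> (inf v e) \<le> 0 + \<epsilon>" if "0 < \<epsilon>" for \<epsilon>
    proof -
      have "\<forall>\<^sub>F N in sequentially. \<forall>M. \<phi> (inf (running_sup (\<lambda>k. f (N + k)) M) e) \<le> \<epsilon>"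
        using f(1) that by (simp add: tail_sup_null_def)
      from eventually_happens'[OF sequentially_bot this]
      obtain N where N: "\<And>M. \<phi> (inf (running_sup (\<lambda>k. f (N + k)) M) e) \<le> \<epsilon>" by blast
      have "\<phi> (inf (G N) e) \<le> \<epsilon>"
      proof (rule limit_le_bound[OF functional_tendsto[OF tendsto_inf_const[OF S_lim]]])
        fix M
        have "\<phi> (inf (S N M) e) \<le> \<phi> (inf (running_sup (\<lambda>k. f (N + k)) M) e)"
          unfolding S_def by (intro functional_mono inf_mono running_sup_mono order_refl inf_le1)
        then show "\<phi> (inf (S N M) e) \<le> \<epsilon>" using N order_trans by blast
      qed
      moreover have "\<phi> (inf v e) \<le> \<phi> (inf (G N) e)"
        by (intro functional_mono inf_mono v order_refl)
      ultimately show ?thesis by simp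
    qed
    then have "\<phi> (inf v e) \<le> 0" by (rule field_le_epsilon)
    moreover have "0 \<le> inf v e" using v unit_nonneg by simp
    ultimately have "inf v e = 0" using functional_eq_0 functional_nonneg by (metis antisym)
    then have "v = 0" using disjoint_unit v by blast
    then show "l \<le> 0" by (metis v_def sup_ge1)
  qed (use dec G0 in auto)
  show "\<forall>\<^sub>F n in sequentially. \<bar>inf (f n) y - 0\<bar> \<le> G N" for N
    using f(2) eventually_ge_at_top[of N]
    by eventually_elim (use y upper in simp)
qed

lemma tail_sup_null_imp_uo_tendsto:
  "tail_sup_null (\<lambda>n. \<bar>f n - l\<bar>) \<Longrightarrow> uo_tendsto f l sequentially"
  unfolding uo_tendsto_def by (auto intro: tail_sup_null_order_tendsto)

lemma tail_sup_null_supermartingale: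
  assumes adapted: "\<And>n. 1 \<le> n \<Longrightarrow> E n (d n) = d n"
    and nonneg: "\<And>n. 1 \<le> n \<Longrightarrow> 0 \<le> d n"
    and super: "\<And>n. 1 \<le> n \<Longrightarrow> E n (d (Suc n)) \<le> d n"
    and null: "(\<lambda>n. \<phi> (d n)) \<longlonglongrightarrow> 0"
  shows "tail_sup_null d"
  unfolding tail_sup_null_def
proof (intro allI impI)
  fix \<epsilon> :: real assume \<epsilon>: "0 < \<epsilon>"
  have \<phi>e: "0 \<le> \<phi> e" by (intro functional_nonneg unit_nonneg)
  \<comment> \<open>The level makes the first term of the maximal inequality at most \<open>\<epsilon> / 2\<close>; the second one is then
    small once \<open>\<phi> (d N)\<close> is.\<close>
  define c where "c = \<epsilon> / (2 * (\<phi> e + 1))"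
  have c: "0 < c" using \<epsilon> \<phi>e by (simp add: c_def)
  have c\<phi>: "c * \<phi> e \<le> \<epsilon> / 2" using \<epsilon> \<phi>e by (simp add: c_def field_simps)
  have "\<forall>\<^sub>F N in sequentially. \<phi> (d N) < c * (\<epsilon> / 2)"
    by (rule order_tendstoD(2)[OF null]) (use c \<epsilon> in simp)
  then show "\<forall>\<^sub>F N in sequentially. \<forall>M. \<phi> (inf (running_sup (\<lambda>k. d (N + k)) M) e) \<le> \<epsilon>"
    using eventually_ge_at_top[of 1]
  proof eventually_elim
    case (elim N)
    show ?case
    proof
      fix M
      have "\<phi> (inf (running_sup (\<lambda>k. d (N + k)) M) e) \<le> c * \<phi> e + \<phi> (d (N + 0)) / c"
        by (rule doob_maximal_inequality[OF elim(2) c])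
          (use elim(2) super[of "N + _"] in \<open>auto intro: adapted nonneg\<close>)
      also have "\<dots> \<le> \<epsilon> / 2 + \<epsilon> / 2"
        using c\<phi> elim(1) c by (intro add_mono) (simp_all add: field_simps)
      finally show "\<phi> (inf (running_sup (\<lambda>k. d (N + k)) M) e) \<le> \<epsilon>" by simp
    qed
  qed
qed

section \<open>Closed martingales\<close>

text \<open>The union of the ranges of the projections, written through their fixed points.\<close>

definition range_union :: "'a set" where
  "range_union = {v. \<exists>m\<ge>1. E m v = v}"

lemma subspace_range_union: "subspace range_union"
proof (rule subspaceI)
  show "0 \<in> range_union"
    using linear_0[OF linear_E[of 1]] by (auto simp: range_union_def)
  show "c *\<^sub>R v \<in> range_union" if "v \<in> range_union" for c v
    using that linear_scale[OF linear_E] by (force simp: range_union_def)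
  fix v w assume "v \<in> range_union" "w \<in> range_union"
  then obtain m m' where "1 \<le> m" "1 \<le> m'" "E m v = v" "E m' w = w" by (auto simp: range_union_def)
  then have "1 \<le> max m m'" "E (max m m') (v + w) = v + w"
    using E_fixed_mono[of m "max m m'" v] E_fixed_mono[of m' "max m m'" w] linear_add[OF linear_E[of "max m m'"]]
    by simp_all
  then show "v + w \<in> range_union" by (auto simp: range_union_def)
qed

lemma E_norm_bound:
  obtains K where "0 < K" "\<And>n x. 1 \<le> n \<Longrightarrow> norm (E n x) \<le> K * norm x"
proof -
  obtain K where K: "\<And>n. 1 \<le> n \<Longrightarrow> onorm (E n) \<le> K"
    using bounded by (auto simp: bounded_filtration_def bdd_above_def)
  have "norm (E n x) \<le> max K 1 * norm x" if "1 \<le> n" for n x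
  proof -
    have "norm (E n x) \<le> onorm (E n) * norm x" by (rule onorm[OF bounded_linear_E[OF that]])
    also have "\<dots> \<le> max K 1 * norm x" using K[OF that] by (intro mult_right_mono) auto
    finally show ?thesis .
  qed
  then show ?thesis by (intro that[of "max K 1"]) auto
qed

lemma abs_E_le: "1 \<le> n \<Longrightarrow> \<bar>E n x\<bar> \<le> E n \<bar>x\<bar>"
  using E_mono[of n x "\<bar>x\<bar>"] E_mono[of n "- x" "\<bar>x\<bar>"] linear_neg[OF linear_E, of n x]
  by (intro abs_leI) (simp_all add: abs_ge_self abs_ge_minus_self)

text \<open>Once \<open>v\<close> belongs to the range, \<open>E n\<close> acts on \<open>l\<close> with an error controlled by \<open>l - v\<close> alone.\<close>

lemma E_error_le:
  assumes n: "1 \<le> n" and "E n v = v"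
  shows "\<bar>E n l - l\<bar> \<le> E n \<bar>l - v\<bar> + \<bar>l - v\<bar>"
proof -
  have "E n l - l = E n (l - v) - (l - v)" using assms by (simp add: linear_diff[OF linear_E])
  then have "\<bar>E n l - l\<bar> \<le> \<bar>E n (l - v)\<bar> + \<bar>l - v\<bar>" by (simp only: abs_triangle_ineq4)
  also have "\<dots> \<le> E n \<bar>l - v\<bar> + \<bar>l - v\<bar>" by (intro add_right_mono abs_E_le n)
  finally show ?thesis .
qed

text \<open>Uniform boundedness of the projections extends the convergence from the union of the ranges, where
it is eventually an equality, to the closure.\<close>

lemma closed_martingale_tendsto:
  assumes l: "l \<in> closure range_union"
  shows "(\<lambda>n. E n l) \<longlonglongrightarrow> l"
proof (rule metric_LIMSEQ_I)
  fix \<epsilon> :: real assume \<epsilon>: "0 < \<epsilon>"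
  obtain K where K: "0 < K" "\<And>n x. 1 \<le> n \<Longrightarrow> norm (E n x) \<le> K * norm x" using E_norm_bound by blast
  have "0 < \<epsilon> / (K + 1)" using \<epsilon> K by simp
  then obtain v where v: "v \<in> range_union" "dist v l < \<epsilon> / (K + 1)"
    using l unfolding closure_approachable by blast
  then obtain m where m: "1 \<le> m" "E m v = v" by (auto simp: range_union_def)
  have "dist (E n l) l < \<epsilon>" if "m \<le> n" for n
  proof -
    have n: "1 \<le> n" "E n v = v" using m that E_fixed_mono[OF m(1) that] by auto
    have "dist (E n l) l = norm \<bar>E n l - l\<bar>" by (simp add: dist_norm)
    also have "\<dots> \<le> norm (E n \<bar>l - v\<bar> + \<bar>l - v\<bar>)"
      by (intro norm_mono_nonneg E_error_le n) simp
    also have "\<dots> \<le> K * norm \<bar>l - v\<bar> + norm \<bar>l - v\<bar>"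
      by (intro order_trans[OF norm_triangle_ineq] add_right_mono K n)
    also have "\<dots> = (K + 1) * dist v l" by (simp add: dist_norm norm_minus_commute algebra_simps)
    also have "\<dots> < \<epsilon>" using v(2) K by (simp add: field_simps)
    finally show ?thesis .
  qed
  then show "\<exists>m. \<forall>n\<ge>m. dist (E n l) l < \<epsilon>" by blast
qed

text \<open>Approximate \<open>l\<close> by an element \<open>v\<close> of some range and put \<open>w = \<bar>l - v\<bar>\<close>. From some index on the error at \<open>n\<close> is
at most \<open>E n w + w\<close>, and the maximal inequality for the martingale \<open>E n w\<close> bounds the tail suprema
by a quantity that is small with \<open>\<phi> w\<close>.\<close>

lemma closed_martingale_tail_sup_null:
  assumes l: "l \<in> closure range_union"
  shows "tail_sup_null (\<lambda>n. \<bar>E n l - l\<bar>)"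
  unfolding tail_sup_null_def
proof (intro allI impI)
  fix \<epsilon> :: real assume \<epsilon>: "0 < \<epsilon>"
  have \<phi>e: "0 \<le> \<phi> e" by (intro functional_nonneg unit_nonneg)
  define c where "c = \<epsilon> / (3 * (\<phi> e + 1))"
  have c: "0 < c" using \<epsilon> \<phi>e by (simp add: c_def)
  have c\<phi>: "c * \<phi> e \<le> \<epsilon> / 3" using \<epsilon> \<phi>e by (simp add: c_def field_simps)
  obtain x where x: "\<And>i. x i \<in> range_union" "x \<longlonglongrightarrow> l"
    using l unfolding closure_sequential by blast
  have "(\<lambda>i. \<bar>l - x i\<bar>) \<longlonglongrightarrow> 0"
    using tendsto_norm_zero[OF LIM_zero[OF x(2)]] by (subst tendsto_norm_zero_iff[symmetric]) (simp add: norm_minus_commute)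
  from functional_tendsto[OF this] have "(\<lambda>i. \<phi> \<bar>l - x i\<bar>) \<longlonglongrightarrow> 0"
    by (simp add: linear_0[OF functional_linear])
  then have "\<forall>\<^sub>F i in sequentially. \<phi> \<bar>l - x i\<bar> < min (\<epsilon> / 3) (c * (\<epsilon> / 3))"
    by (rule order_tendstoD(2)) (use c \<epsilon> in simp)
  then obtain i where i: "\<phi> \<bar>l - x i\<bar> < \<epsilon> / 3" "\<phi> \<bar>l - x i\<bar> < c * (\<epsilon> / 3)"
    using eventually_happens'[OF sequentially_bot] by fastforce
  define w where "w = \<bar>l - x i\<bar>"
  have w: "0 \<le> w" by (simp add: w_def)
  obtain m where m: "1 \<le> m" "E m (x i) = x i" using x(1) by (auto simp: range_union_def)
  show "\<forall>\<^sub>F N in sequentially. \<forall>M. \<phi> (inf (running_sup (\<lambda>k. \<bar>E (N + k) l - l\<bar>) M) e) \<le> \<epsilon>"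
    using eventually_ge_at_top[of m]
  proof eventually_elim
    case (elim N)
    show ?case
    proof
      fix M
      have N: "1 \<le> N" using elim m by simp
      let ?D = "running_sup (\<lambda>k. E (N + k) w) M"
      have "running_sup (\<lambda>k. \<bar>E (N + k) l - l\<bar>) M \<le> ?D + w"
      proof (rule running_sup_least)
        show "0 \<le> ?D + w" by (intro add_nonneg_nonneg running_sup_nonneg w)
        fix k assume "k < M"
        have "\<bar>E (N + k) l - l\<bar> \<le> E (N + k) w + w"
          unfolding w_def using E_fixed_mono[OF m(1) _ m(2), of "N + k"] elim N by (intro E_error_le) auto
        also have "\<dots> \<le> ?D + w"
          using running_sup_upper[OF \<open>k < M\<close>, of "\<lambda>k. E (N + k) w"] by (rule add_right_mono)
        finally show "\<bar>E (N + k) l - l\<bar> \<le> ?D + w" .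
      qed
      then have "inf (running_sup (\<lambda>k. \<bar>E (N + k) l - l\<bar>) M) e \<le> inf (?D + w) e"
        by (intro inf_mono order_refl)
      also have "\<dots> \<le> inf ?D e + inf w e" by (intro inf_add_le running_sup_nonneg w unit_nonneg)
      also have "\<dots> \<le> inf ?D e + w" by (intro add_left_mono inf_le1)
      finally have "\<phi> (inf (running_sup (\<lambda>k. \<bar>E (N + k) l - l\<bar>) M) e) \<le> \<phi> (inf ?D e + w)"
        by (rule functional_mono)
      also have "\<dots> = \<phi> (inf ?D e) + \<phi> w" by (rule linear_add[OF functional_linear])
      also have "\<phi> (inf ?D e) \<le> c * \<phi> e + \<phi> (E (N + 0) w) / c"
        by (rule doob_maximal_inequality[OF N c]) (use N w in \<open>auto simp: E_E E_nonneg min_def\<close>)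
      also have "\<phi> (E (N + 0) w) = \<phi> w" using functional_E[OF N] by simp
      also have "c * \<phi> e + \<phi> w / c + \<phi> w \<le> \<epsilon> / 3 + \<epsilon> / 3 + \<epsilon> / 3"
        using c\<phi> i c by (intro add_mono) (simp_all add: w_def field_simps)
      finally show "\<phi> (inf (running_sup (\<lambda>k. \<bar>E (N + k) l - l\<bar>) M) e) \<le> \<epsilon>" by simp
    qed
  qed
qed

section \<open>Weak limits of subsequences\<close>

lemma weak_limit_in_closure_range_union:
  assumes s: "\<And>k. 1 \<le> s k" and adapted: "\<And>n. 1 \<le> n \<Longrightarrow> E n (x n) = x n"
    and weak: "weakly_tendsto (x \<circ> s) l sequentially"
  shows "l \<in> closure range_union"
proof (rule weak_limit_in_closure_subspace[OF subspace_range_union _ weak])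
  show "\<forall>\<^sub>F k in sequentially. (x \<circ> s) k \<in> range_union"
    using s adapted unfolding range_union_def by (intro always_eventually) fastforce
qed simp

text \<open>For fixed \<open>n\<close>, bounded operators preserve weak limits and the positive cone is weakly closed, so
\<open>z n \<le> E n (z m)\<close> survives the passage to the limit along the subsequence.\<close>

lemma submartingale_le_E_weak_limit:
  assumes s: "strict_mono s" and sub: "\<And>m. n \<le> m \<Longrightarrow> z n \<le> E n (z m)"
    and weak: "weakly_tendsto (z \<circ> s) l sequentially" and n: "1 \<le> n"
  shows "z n \<le> E n l"
proof -
  have "weakly_tendsto (\<lambda>k. E n (z (s k)) - z n) (E n l - z n) sequentially"
    unfolding weakly_tendsto_def
  proof (intro allI impI)
    fix \<psi> :: "'a \<Rightarrow> real" assume \<psi>: "bounded_linear \<psi>"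
    have "bounded_linear (\<lambda>x. \<psi> (E n x))"
      by (rule bounded_linear_compose[OF \<psi> bounded_linear_E[OF n]])
    then have "(\<lambda>k. \<psi> (E n (z (s k)))) \<longlonglongrightarrow> \<psi> (E n l)"
      using weak[unfolded weakly_tendsto_def] by fastforce
    then show "(\<lambda>k. \<psi> (E n (z (s k)) - z n)) \<longlonglongrightarrow> \<psi> (E n l - z n)"
      using linear_diff[OF bounded_linear.linear[OF \<psi>]] by (auto intro: tendsto_diff)
  qed
  moreover have "\<forall>\<^sub>F k in sequentially. 0 \<le> E n (z (s k)) - z n"
    using eventually_ge_at_top[of n]
    by eventually_elim (use sub strict_mono_imp_increasing[OF s] in \<open>auto intro: order_trans\<close>)
  ultimately have "0 \<le> E n l - z n" by (intro weak_limit_nonneg) auto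
  then show ?thesis by simp
qed

text \<open>A martingale and its negative are both submartingales, so the weak limit closes it: \<open>x n = E n l\<close>.\<close>

theorem martingale_convergence:
  assumes mart: "martingale_rel E x" and s: "strict_mono s" "\<And>k. 1 \<le> s k"
    and weak: "weakly_tendsto (x \<circ> s) l sequentially"
  shows "uo_tendsto x l sequentially" "x \<longlonglongrightarrow> l"
proof -
  have E_x: "E n (x m) = x n" if "1 \<le> n" "n \<le> m" for n m
    using mart that by (simp add: martingale_rel_def)
  have x_eq: "x n = E n l" if n: "1 \<le> n" for n
  proof (rule antisym)
    show "x n \<le> E n l"
      by (rule submartingale_le_E_weak_limit[OF s(1) _ weak n]) (simp add: E_x[OF n])
    have neg: "weakly_tendsto ((\<lambda>n. - x n) \<circ> s) (- l) sequentially"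
      unfolding weakly_tendsto_def
    proof (intro allI impI)
      fix \<psi> :: "'a \<Rightarrow> real" assume \<psi>: "bounded_linear \<psi>"
      then have "(\<lambda>k. - \<psi> ((x \<circ> s) k)) \<longlonglongrightarrow> - \<psi> l"
        using weak by (intro tendsto_minus) (simp add: weakly_tendsto_def)
      then show "(\<lambda>k. \<psi> (((\<lambda>n. - x n) \<circ> s) k)) \<longlonglongrightarrow> \<psi> (- l)"
        using linear_neg[OF bounded_linear.linear[OF \<psi>]] by simp
    qed
    have "- x n \<le> E n (- l)"
      by (rule submartingale_le_E_weak_limit[OF s(1) _ neg n]) (simp add: E_x[OF n] linear_neg[OF linear_E[OF n]])
    then show "E n l \<le> x n" by (simp add: linear_neg[OF linear_E[OF n]])
  qed
  have l: "l \<in> closure range_union"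
    by (rule weak_limit_in_closure_range_union[OF s(2) _ weak]) (simp add: E_x)
  show "x \<longlonglongrightarrow> l"
    by (rule Lim_transform_eventually[OF closed_martingale_tendsto[OF l]])
      (use eventually_ge_at_top[of 1] in eventually_elim, simp add: x_eq)
  show "uo_tendsto x l sequentially"
    by (rule tail_sup_null_imp_uo_tendsto, rule tail_sup_null_mono[OF closed_martingale_tail_sup_null[OF l]])
      (use eventually_ge_at_top[of 1] in eventually_elim, simp add: x_eq)
qed

text \<open>The difference \<open>d n = E n l - z n\<close> is a non-negative supermartingale, so \<open>\<phi> (d n)\<close> decreases; along the
subsequence it tends to 0 by weak convergence. The maximal inequality then makes \<open>d\<close> null in the
sense of tail suprema, so \<open>z n\<close> inherits the unbounded order limit of the martingale \<open>E n l\<close>.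
In norm, only the positive part is controlled from both sides, by 0 and by the positive part of
\<open>E n l\<close>, which converges in norm.\<close>

theorem submartingale_convergence:
  assumes subm: "submartingale_rel E z" and s: "strict_mono s" "\<And>k. 1 \<le> s k"
    and weak: "weakly_tendsto (z \<circ> s) l sequentially"
  shows "uo_tendsto (\<lambda>n. sup (z n) 0) (sup l 0) sequentially"
    and "(\<lambda>n. sup (z n) 0) \<longlonglongrightarrow> sup l 0"
proof -
  have E_z: "E n (z n) = z n" if "1 \<le> n" for n
    using subm that E_E[OF that that] by (auto simp: submartingale_rel_def)
  have sub: "z n \<le> E n (z m)" if "1 \<le> n" "n \<le> m" for n m
    using subm that by (simp add: submartingale_rel_def)
  have l: "l \<in> closure range_union"
    by (rule weak_limit_in_closure_range_union[OF s(2) E_z weak])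
  define d where "d n = E n l - z n" for n
  have d0: "0 \<le> d n" if "1 \<le> n" for n
    using submartingale_le_E_weak_limit[OF s(1) _ weak that] sub that by (simp add: d_def)
  have d_fixed: "E n (d n) = d n" if "1 \<le> n" for n
    using that by (simp add: d_def linear_diff[OF linear_E] E_E E_z)
  have d_super: "E n (d m) \<le> d n" if "1 \<le> n" "n \<le> m" for n m
    using that sub[OF that] by (simp add: d_def linear_diff[OF linear_E] E_E min_absorb2)
  have \<phi>d_nonneg: "0 \<le> \<phi> (d n)" if "1 \<le> n" for n
    using d0[OF that] by (rule functional_nonneg)
  have \<phi>d_antimono: "\<phi> (d m) \<le> \<phi> (d n)" if "1 \<le> n" "n \<le> m" for n m
    using functional_mono[OF d_super[OF that]] functional_E[OF that(1)] by simp
  have d_null: "(\<lambda>n. \<phi> (d n)) \<longlonglongrightarrow> 0"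
  proof (rule LIMSEQ_I)
    fix \<epsilon> :: real assume "0 < \<epsilon>"
    have "(\<lambda>k. \<phi> ((z \<circ> s) k)) \<longlonglongrightarrow> \<phi> l"
      using weak positive_functional_bounded_linear[OF functional_linear functional_nonneg]
      by (simp add: weakly_tendsto_def)
    then have "\<forall>\<^sub>F k in sequentially. \<phi> l - \<epsilon> < \<phi> ((z \<circ> s) k)"
      by (rule order_tendstoD(1)) (use \<open>0 < \<epsilon>\<close> in simp)
    then obtain k where "\<phi> l - \<epsilon> < \<phi> (z (s k))"
      using eventually_happens'[OF sequentially_bot] by fastforce
    then have "\<phi> (d (s k)) < \<epsilon>"
      using functional_E[OF s(2)] by (simp add: d_def linear_diff[OF functional_linear])
    then have "norm (\<phi> (d n) - 0) < \<epsilon>" if "s k \<le> n" for n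
      using \<phi>d_antimono[OF s(2) that] \<phi>d_nonneg[of n] s(2)[of k] that by simp
    then show "\<exists>N. \<forall>n\<ge>N. norm (\<phi> (d n) - 0) < \<epsilon>" by blast
  qed
  have d_small: "tail_sup_null d"
    by (rule tail_sup_null_supermartingale) (use d_fixed d0 d_super d_null in auto)
  show "uo_tendsto (\<lambda>n. sup (z n) 0) (sup l 0) sequentially"
  proof (rule tail_sup_null_imp_uo_tendsto, rule tail_sup_null_mono)
    show "tail_sup_null (\<lambda>n. \<bar>E n l - l\<bar> + d n)"
      by (rule tail_sup_null_add[OF closed_martingale_tail_sup_null[OF l] d_small])
    show "\<forall>\<^sub>F n in sequentially. \<bar>sup (z n) 0 - sup l 0\<bar> \<le> \<bar>E n l - l\<bar> + d n"
      using eventually_ge_at_top[of 1]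
    proof eventually_elim
      case (elim n)
      have "\<bar>sup (z n) 0 - sup l 0\<bar> \<le> \<bar>z n - l\<bar>" by (rule abs_sup_diff_le)
      also have "z n - l = (E n l - l) - d n" by (simp add: d_def)
      also have "\<bar>(E n l - l) - d n\<bar> \<le> \<bar>E n l - l\<bar> + \<bar>d n\<bar>" by (rule abs_triangle_ineq4)
      finally show ?case using d0[OF elim] by simp
    qed
  qed
  \<comment> \<open>The gap \<open>a n\<close> is at most \<open>d n\<close> and at most \<open>sup l 0 + r n\<close>, hence at most \<open>inf (d n) (sup l 0) + r n\<close>,
    where the first term is order null and the second one norm null.\<close>
  define a where "a n = sup (E n l) 0 - sup (z n) 0" for n
  define r where "r n = \<bar>sup (E n l) 0 - sup l 0\<bar>" for n
  have x_lim: "(\<lambda>n. sup (E n l) 0) \<longlonglongrightarrow> sup l 0"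
    by (rule tendsto_sup_const[OF closed_martingale_tendsto[OF l]])
  have "(\<lambda>n. inf (d n) (sup l 0)) \<longlonglongrightarrow> 0"
  proof (rule order_continuous_normD[OF order_continuous tail_sup_null_order_tendsto[OF d_small]])
    show "\<forall>\<^sub>F n in sequentially. 0 \<le> d n"
      using eventually_ge_at_top[of 1] by eventually_elim (rule d0)
  qed simp
  moreover have "r \<longlonglongrightarrow> 0"
    using tendsto_norm_zero[OF LIM_zero[OF x_lim]]
    unfolding r_def by (subst tendsto_norm_zero_iff[symmetric]) simp
  ultimately have "(\<lambda>n. inf (d n) (sup l 0) + r n) \<longlonglongrightarrow> 0"
    by (rule tendsto_add_zero)
  then have "(\<lambda>n. norm (inf (d n) (sup l 0) + r n)) \<longlonglongrightarrow> 0" by (rule tendsto_norm_zero)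
  then have "a \<longlonglongrightarrow> 0"
  proof (rule Lim_null_comparison[rotated])
    show "\<forall>\<^sub>F n in sequentially. norm (a n) \<le> norm (inf (d n) (sup l 0) + r n)"
      using eventually_ge_at_top[of 1]
    proof eventually_elim
      case (elim n)
      have zx: "z n \<le> E n l" using d0[OF elim] by (simp add: d_def)
      have "0 \<le> a n" unfolding a_def using sup_mono[OF zx order_refl[of 0]] by simp
      moreover have "a n \<le> inf (d n) (sup l 0) + r n"
        unfolding add_inf_distrib_right
      proof (rule inf_greatest)
        have "a n \<le> \<bar>sup (E n l) 0 - sup (z n) 0\<bar>" unfolding a_def by (rule abs_ge_self)
        also have "\<dots> \<le> \<bar>E n l - z n\<bar>" by (rule abs_sup_diff_le)
        also have "\<dots> = d n" using d0[OF elim] by (simp add: d_def)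
        also have "\<dots> \<le> d n + r n" by (simp add: r_def)
        finally show "a n \<le> d n + r n" .
        have "a n \<le> sup (E n l) 0" by (simp add: a_def)
        also have "\<dots> = sup l 0 + (sup (E n l) 0 - sup l 0)" by simp
        also have "\<dots> \<le> sup l 0 + r n" unfolding r_def by (intro add_left_mono abs_ge_self)
        finally show "a n \<le> sup l 0 + r n" .
      qed
      ultimately show ?case by (rule norm_mono_nonneg)
    qed
  qed
  from tendsto_diff[OF x_lim this] show "(\<lambda>n. sup (z n) 0) \<longlonglongrightarrow> sup l 0"
    by (simp add: a_def)
qed

end

theorem theorem5p13:
  fixes E :: "nat \<Rightarrow> 'a::banach_lattice \<Rightarrow> 'a"
  assumes "order_continuous_norm TYPE('a)"
    and "bounded_filtration E"
    and "abstract_bistochastic E"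
  shows "(\<forall>(x :: nat \<Rightarrow> 'a) (s :: nat \<Rightarrow> nat) (l :: 'a).
            martingale_rel E x \<longrightarrow> strict_mono s \<longrightarrow> (\<forall>k. 1 \<le> s k) \<longrightarrow>
            weakly_tendsto (x \<circ> s) l sequentially \<longrightarrow>
            uo_tendsto x l sequentially \<and> x \<longlonglongrightarrow> l) \<and>
         (\<forall>(z :: nat \<Rightarrow> 'a) (s :: nat \<Rightarrow> nat) (l :: 'a).
            submartingale_rel E z \<longrightarrow> strict_mono s \<longrightarrow> (\<forall>k. 1 \<le> s k) \<longrightarrow>
            weakly_tendsto (z \<circ> s) l sequentially \<longrightarrow>
            uo_tendsto (\<lambda>n. sup (z n) 0) (sup l 0) sequentially \<and>
            (\<lambda>n. sup (z n) 0) \<longlonglongrightarrow> sup l 0)"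
proof -
  obtain e \<phi> where "weak_unit e" "strictly_positive_functional \<phi>" "E 1 e = e" "\<phi> \<circ> E 1 = \<phi>"
    using assms(3) unfolding abstract_bistochastic_def by blast
  then interpret bistochastic_filtration "TYPE('a)" E e \<phi>
    using assms by unfold_locales
  show ?thesis
    using martingale_convergence submartingale_convergence by blast
qed

end
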